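(* Let $d\ge2$, let $k$ be an integer with $0<k<d$, and suppose $p_c<p<1$. There exists $\eta=\eta(p,k,d)>0$ such that $$\mu(T_n)\ge \exp\left\{-\eta\cdot n^{(d-1)/d}\right\}$$ for all $n$ sufficiently large, where $T_n=T_n(k,d)=\{\gamma\in\mathcal{G}:\beta_k(\gamma)\ge n\}$.
   Context: For $x\in\mathbb{Z}^d$ and a positive integer $\ell$ let $B_\ell(x)=\prod_{i=1}^d[x_i,x_i+\ell]$. Each point of $\mathbb{Z}^d$ is independently colored black with probability $p\in(0,1)$ and white with probability $1-p$; $Z$ is the random set of black points, and $\Phi=\big(\bigcup_{z\in Z}B_1(z)\big)^{\circ}$ is the interior (in $\mathbb{R}^d$) of the union of the black unit cubes. Let $C_0$ be the (possibly empty) connected component of $\Phi$ containing the interior of $B_1(0)$, $|C_0|$ the number of unit cubes in it, $\theta(p)=\mathbb{P}\{|C_0|=\infty\}$, and $p_c=\inf\{p:\theta(p)>0\}$ the critical probability. $\mathcal{G}$ denotes the (countable) set of equivalence classes, up to homotopy equivalence, of finite connected $d$-dimensional cubical complexes, i.e. of nonempty connected sets of the form $\big(\bigcup_{z\in F}B_1(z)\big)^{\circ}$ with $F\subset\mathbb{Z}^d$ finite. For $\gamma\in\mathcal{G}$, $\beta_k(\gamma)$ is the $k$th Betti number of $\gamma$. For a positive integer $L$, let $W_L(0)=\prod_{i=1}^d[-\lfloor L/2\rfloor,\lceil L/2\rceil]$, let $\Phi_L$ be the union of the connected components of $\Phi$ completely contained in $W_L(0)$, and let $b_0(\Phi_L)$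 be the number of its components. Let $\mu_L=\frac{1}{b_0(\Phi_L)}\sum_{s}\delta_{[s]}$, the sum being over connected components $s$ of $\Phi_L$, with $[s]\in\mathcal{G}$ the homotopy type of $s$ (on the event $b_0(\Phi_L)=0$, $\mu_L$ is an arbitrary fixed probability measure on $\mathcal{G}$). As $L\to\infty$ the random measures $\mu_L$ converge in probability, with respect to total variation distance, to a deterministic probability measure on $\mathcal{G}$; this limit (which depends on $p$ and $d$) is denoted $\mu$. *)

theory Defs
  imports "HOL-Probability.Probability" "HOL-Homology.Homology"
begin

section \<open>Cubes and site percolation\<close>

definition cube :: "nat \<Rightarrow> int ^ 'd \<Rightarrow> (real ^ 'd) set" where
  "cube l x = cbox (\<chi> i. of_int (x $ i)) (\<chi> i. of_int (x $ i) + of_nat l)"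

definition cubes_interior :: "(int ^ 'd::finite) set \<Rightarrow> (real ^ 'd) set" where
  "cubes_interior F = interior (\<Union>z\<in>F. cube 1 z)"

text \<open>A colouring is a function \<open>\<omega>\<close> with \<open>\<omega> z\<close> true iff the site \<open>z\<close> is black.\<close>

definition percolation :: "real \<Rightarrow> (int ^ 'd::finite \<Rightarrow> bool) measure" where
  "percolation p = PiM UNIV (\<lambda>_. measure_pmf (bernoulli_pmf p))"

definition black_region :: "(int ^ 'd::finite \<Rightarrow> bool) \<Rightarrow> (real ^ 'd) set" where
  "black_region \<omega> = cubes_interior {z. \<omega> z}"

text \<open>At most one component contains the interior of the cube at the origin, so the union below is
  that component, or empty if there is none.\<close>

definition origin_component :: "(int ^ 'd::finite \<Rightarrow> bool) \<Rightarrow> (real ^ 'd) set" where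
  "origin_component \<omega> = \<Union>{C \<in> components (black_region \<omega>). interior (cube 1 0) \<subseteq> C}"

text \<open>Components of the black region are open, so the unit cubes ``in'' such a component are those
  whose interior it contains.\<close>

definition cubes_in :: "(real ^ 'd::finite) set \<Rightarrow> (int ^ 'd) set" where
  "cubes_in C = {z. interior (cube 1 z) \<subseteq> C}"

definition percolation_prob :: "'d::finite itself \<Rightarrow> real \<Rightarrow> real" where
  "percolation_prob _ p =
     measure (percolation p) {\<omega> :: int ^ 'd \<Rightarrow> bool. infinite (cubes_in (origin_component \<omega>))}"

text \<open>The parameter is restricted to \<open>[0,1]\<close>, outside of which \<^const>\<open>bernoulli_pmf\<close> clips it.\<close>

definition critical_prob :: "'d::finite itself \<Rightarrow> real" where
  "critical_prob d = Inf {p \<in> {0..1}. percolation_prob d p > 0}"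


section \<open>Homotopy types of finite connected cubical complexes\<close>

definition finite_complexes :: "(real ^ 'd::finite) set set" where
  "finite_complexes = {S. S \<noteq> {} \<and> connected S \<and> (\<exists>F. finite F \<and> S = cubes_interior F)}"

definition htpy_rel :: "((real ^ 'd::finite) set \<times> (real ^ 'd) set) set" where
  "htpy_rel = {(S, T). S \<in> finite_complexes \<and> T \<in> finite_complexes \<and> S homotopy_eqv T}"

definition htpy_types :: "(real ^ 'd::finite) set set set" where
  "htpy_types = finite_complexes // htpy_rel"

definition htpy_type :: "(real ^ 'd::finite) set \<Rightarrow> (real ^ 'd) set set" where
  "htpy_type S = htpy_rel `` {S}"

lemma equiv_htpy_rel: "equiv finite_complexes htpy_rel"
proof (rule equivI)
  show "htpy_rel \<subseteq> finite_complexes \<times> (finite_complexes :: (real ^ 'd) set set)"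
    by (auto simp: htpy_rel_def)
  show "refl_on finite_complexes (htpy_rel :: ((real ^ 'd) set \<times> _) set)"
    by (auto simp: htpy_rel_def refl_on_def homotopy_equivalent_space_refl)
  show "sym (htpy_rel :: ((real ^ 'd) set \<times> _) set)"
    unfolding sym_def htpy_rel_def using homotopy_equivalent_space_sym by fast
  show "trans (htpy_rel :: ((real ^ 'd) set \<times> _) set)"
    unfolding trans_def htpy_rel_def using homotopy_eqv_trans by fast
qed


section \<open>Betti numbers\<close>

text \<open>The Betti number is the rank of integral singular homology; the rank of an abelian group is
  the largest size of a \<open>\<int>\<close>-linearly independent set (multiplicative notation).\<close>

definition Z_independent :: "('a, 'b) monoid_scheme \<Rightarrow> 'a set \<Rightarrow> bool" where
  "Z_independent G B \<longleftrightarrow> B \<subseteq> carrier G \<and> finite B \<and>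
     (\<forall>c :: 'a \<Rightarrow> int. finprod G (\<lambda>b. b [^]\<^bsub>G\<^esub> c b) B = \<one>\<^bsub>G\<^esub> \<longrightarrow> (\<forall>b\<in>B. c b = 0))"

definition abelian_rank :: "('a, 'b) monoid_scheme \<Rightarrow> enat" where
  "abelian_rank G = (SUP B \<in> {B. Z_independent G B}. enat (card B))"

definition betti :: "nat \<Rightarrow> 'a::topological_space set \<Rightarrow> enat" where
  "betti k S = abelian_rank (homology_group (int k) (top_of_set S))"

text \<open>Betti numbers are constant on homotopy types (lemma \<open>betti_type_eq\<close> below), so the image is
  a singleton.\<close>

definition betti_type :: "nat \<Rightarrow> (real ^ 'd::finite) set set \<Rightarrow> enat" where
  "betti_type k \<gamma> = the_elem (betti k ` \<gamma>)"

lemma Z_independent_image: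
  assumes G: "comm_group G" and H: "comm_group H" and f: "f \<in> iso G H" and B: "Z_independent G B"
  shows "Z_independent H (f ` B)" "card (f ` B) = card B"
proof -
  interpret G: comm_group G by fact
  interpret H: comm_group H by fact
  interpret f: group_hom G H f
    using f by unfold_locales (auto simp: iso_def)
  have sub: "B \<subseteq> carrier G" and fin: "finite B" using B by (auto simp: Z_independent_def)
  have inj: "inj_on f (carrier G)" using f by (auto simp: iso_def bij_betw_def)
  then have injB: "inj_on f B" using sub by (rule inj_on_subset)
  then show "card (f ` B) = card B" by (rule card_image)
  have "\<forall>b\<in>f ` B. c b = 0" if c: "finprod H (\<lambda>b. b [^]\<^bsub>H\<^esub> c b) (f ` B) = \<one>\<^bsub>H\<^esub>" for c :: "'c \<Rightarrow> int"
  proof -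
    have fB: "f ` B \<subseteq> carrier H" using sub f.hom_closed by auto
    have "f (finprod G (\<lambda>b. b [^]\<^bsub>G\<^esub> c (f b)) B) = finprod H (\<lambda>b. f b [^]\<^bsub>H\<^esub> c (f b)) B"
      using fin sub
    proof (induction B rule: finite_induct)
      case (insert x B)
      have "(\<lambda>b. b [^]\<^bsub>G\<^esub> c (f b)) \<in> B \<rightarrow> carrier G" "(\<lambda>b. f b [^]\<^bsub>H\<^esub> c (f b)) \<in> B \<rightarrow> carrier H"
        using insert.prems by auto
      then show ?case
        using insert by (simp add: G.finprod_insert H.finprod_insert G.finprod_closed f.hom_int_pow)
    qed simp
    also have "\<dots> = finprod H (\<lambda>b. b [^]\<^bsub>H\<^esub> c b) (f ` B)"
      using fB injB by (subst H.finprod_reindex) auto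
    finally have "f (finprod G (\<lambda>b. b [^]\<^bsub>G\<^esub> c (f b)) B) = f \<one>\<^bsub>G\<^esub>" using c by simp
    moreover have "finprod G (\<lambda>b. b [^]\<^bsub>G\<^esub> c (f b)) B \<in> carrier G"
      using sub by (intro G.finprod_closed) auto
    ultimately have "finprod G (\<lambda>b. b [^]\<^bsub>G\<^esub> c (f b)) B = \<one>\<^bsub>G\<^esub>"
      using inj_onD[OF inj, of _ "\<one>\<^bsub>G\<^esub>"] G.one_closed by blast
    then show ?thesis using B by (auto simp: Z_independent_def dest: spec[of _ "c \<circ> f"])
  qed
  then show "Z_independent H (f ` B)"
    using sub fin f.hom_closed by (auto simp: Z_independent_def)
qed

lemma abelian_rank_le:
  assumes "comm_group G" "comm_group H" "G \<cong> H"
  shows "abelian_rank G \<le> abelian_rank H"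
proof -
  obtain f where f: "f \<in> iso G H" using assms(3) by (auto simp: is_iso_def)
  show ?thesis
    unfolding abelian_rank_def
  proof (rule SUP_mono)
    fix B assume "B \<in> {B. Z_independent G B}"
    then have "Z_independent G B" by simp
    note * = Z_independent_image[OF assms(1,2) f this]
    show "\<exists>B'\<in>{B. Z_independent H B}. enat (card B) \<le> enat (card B')"
      by (rule bexI[of _ "f ` B"]) (simp_all add: *)
  qed
qed

lemma betti_cong:
  assumes "S homotopy_eqv T"
  shows "betti k S = betti k T"
proof (rule antisym)
  show "betti k S \<le> betti k T"
    unfolding betti_def using assms
    by (intro abelian_rank_le abelian_homology_group
        homotopy_equivalent_space_imp_isomorphic_homology_groups)
  have "T homotopy_eqv S"
    using assms by (rule homotopy_equivalent_space_sym[THEN iffD1])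
  then show "betti k T \<le> betti k S"
    unfolding betti_def
    by (intro abelian_rank_le abelian_homology_group
        homotopy_equivalent_space_imp_isomorphic_homology_groups)
qed

lemma betti_type_eq:
  assumes "\<gamma> \<in> htpy_types" "S \<in> \<gamma>"
  shows "betti_type k \<gamma> = betti k S"
proof -
  have "betti k T = betti k S" if "T \<in> \<gamma>" for T
  proof (rule betti_cong)
    have "(T, S) \<in> htpy_rel"
      using quotient_eq_iff[OF equiv_htpy_rel, of \<gamma> \<gamma> T S] assms that
      unfolding htpy_types_def by blast
    then show "T homotopy_eqv S" unfolding htpy_rel_def by blast
  qed
  then have "betti k ` \<gamma> = {betti k S}" using assms(2) by blast
  then show ?thesis by (simp add: betti_type_def)
qed

definition betti_ge :: "nat \<Rightarrow> nat \<Rightarrow> (real ^ 'd::finite) set set set" where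
  "betti_ge k n = {\<gamma> \<in> htpy_types. betti_type k \<gamma> \<ge> enat n}"


section \<open>The empirical law of homotopy types and its limit\<close>

definition window :: "nat \<Rightarrow> (real ^ 'd::finite) set" where
  "window L = cbox (\<chi> i. - of_int \<lfloor>real L / 2\<rfloor>) (\<chi> i. of_int \<lceil>real L / 2\<rceil>)"

definition black_region_in :: "nat \<Rightarrow> (int ^ 'd::finite \<Rightarrow> bool) \<Rightarrow> (real ^ 'd) set" where
  "black_region_in L \<omega> = \<Union>{C \<in> components (black_region \<omega>). C \<subseteq> window L}"

definition b0 :: "nat \<Rightarrow> (int ^ 'd::finite \<Rightarrow> bool) \<Rightarrow> nat" where
  "b0 L \<omega> = card (components (black_region_in L \<omega>))"

text \<open>Probability measures on the countable set of homotopy types are represented by probability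
  mass functions supported there. \<open>\<nu>\<close> is the arbitrary fixed measure used when there is no
  component. The other branch is the average of the Dirac masses at the homotopy types of the
  components (lemma \<open>prob_empirical_law\<close> below).\<close>

definition empirical_law ::
  "(real ^ 'd::finite) set set pmf \<Rightarrow> nat \<Rightarrow> (int ^ 'd \<Rightarrow> bool) \<Rightarrow> (real ^ 'd) set set pmf" where
  "empirical_law \<nu> L \<omega> =
     (if b0 L \<omega> = 0 then \<nu> else map_pmf htpy_type (pmf_of_set (components (black_region_in L \<omega>))))"

lemma prob_empirical_law:
  assumes "b0 L \<omega> \<noteq> 0"
  shows "measure_pmf.prob (empirical_law \<nu> L \<omega>) A =
    1 / real (b0 L \<omega>) * (\<Sum>s\<in>components (black_region_in L \<omega>). indicator A (htpy_type s))"
proof -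
  let ?K = "components (black_region_in L \<omega>)"
  have K: "finite ?K" "?K \<noteq> {}" using assms by (auto simp: b0_def card_eq_0_iff)
  have "(\<Sum>s\<in>?K. indicator A (htpy_type s)) = (\<Sum>s\<in>?K. indicator (htpy_type -` A) s :: real)"
    by (intro sum.cong) (auto simp: indicator_def)
  also have "\<dots> = real (card (?K \<inter> htpy_type -` A))"
    using K(1) by (simp add: indicator_def sum.If_cases Int_def)
  finally show ?thesis
    using K assms by (simp add: empirical_law_def b0_def measure_pmf_of_set)
qed

definition tv_dist :: "'a pmf \<Rightarrow> 'a pmf \<Rightarrow> real" where
  "tv_dist P Q = (SUP A. \<bar>measure_pmf.prob P A - measure_pmf.prob Q A\<bar>)"

text \<open>\<open>\<mu>\<close> is the limit in probability, in total variation, of the empirical laws.\<close>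

definition is_limit_law ::
  "real \<Rightarrow> (real ^ 'd::finite) set set pmf \<Rightarrow> (real ^ 'd) set set pmf \<Rightarrow> bool" where
  "is_limit_law p \<nu> \<mu> \<longleftrightarrow> set_pmf \<mu> \<subseteq> htpy_types \<and>
     (\<forall>\<epsilon>>0. (\<lambda>L. measure (percolation p) {\<omega>. tv_dist (empirical_law \<nu> L \<omega>) \<mu> > \<epsilon>})
        \<longlonglongrightarrow> 0)"

end

theory Submission
  imports Defs
begin

text \<open>
  Consider a box of side of order \<open>n powr (1/d)\<close> whose boundary layer of sites is black and whose
  next layer is white. This configuration has a probability exponentially small in the number of
  sites of the two layers only, that is, in \<open>n powr ((d-1)/d)\<close>. Once it is present, the component
  of the boundary layer is confined to the box, and it contains every site of the box that is joined
  to the boundary layer. Above the critical probability a site has a black path to any given distance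
  with a probability at least some \<open>\<theta> > 0\<close> (\<open>arm_prob\<close>), and a path that leaves the box
  meets the boundary layer. So a positive fraction of the sites of the box is
  expected to lie in this one component.

  To create homology, prescribe the colours near each site of a grid in the box: a thickened
  \<open>k\<close>-sphere of black cubes, called a ring, surrounded by white cubes except for one black cube
  that ties it to a black hull. This gadget costs a constant factor, and a long
  path from its centre, cut where it leaves the hull for the last time, joins the hull to the boundary
  layer (\<open>exit_connected_to_corner\<close>). There is a continuous map from the whole component to
  the \<open>k\<close>-sphere that is the radial projection on the ring of a given gadget and is constant away
  from it, because the only exit from the ring is a single cube, over which the projection can be
  contracted to a point. Such maps detect the rings one at a time, so the rings are
  linearly independent in homology (\<open>card_gadgets_le_betti\<close>). A sum of indicators with large mean
  is large with a probability bounded below (\<open>prob_many_events_ge\<close>), which gives a component with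
  \<open>n\<close> independent classes at a probability \<open>exp (- const * n powr ((d-1)/d))\<close> (\<open>prob_good\<close>).

  Let \<open>q\<close> be this probability. In a window of side \<open>L\<close> the expected number of translates of the
  box that carry such a component is of order \<open>q * L^d\<close>, different translates give different
  components, and there are at most \<open>L^d\<close> components altogether. By the same argument on sums of
  indicators, the empirical law gives mass of order \<open>q\<close> to the homotopy types with large Betti number,
  on an event whose probability does not tend to zero; since the empirical laws converge in probability
  to a deterministic law, that law does so too (\<open>limit_law_ge\<close>).
\<close>

section \<open>Lattice paths\<close>

definition adjacent :: "int ^ 'd::finite \<Rightarrow> int ^ 'd \<Rightarrow> bool" where
  "adjacent z w \<longleftrightarrow> (\<exists>i. w = z + axis i 1 \<or> w = z - axis i 1)"

definition link :: "(int ^ 'd::finite) set \<Rightarrow> ((int ^ 'd) \<times> (int ^ 'd)) set" where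
  "link F = {(z, w). z \<in> F \<and> w \<in> F \<and> adjacent z w}"

definition cluster :: "(int ^ 'd::finite) set \<Rightarrow> int ^ 'd \<Rightarrow> (int ^ 'd) set" where
  "cluster F z = {w \<in> F. (z, w) \<in> (link F)\<^sup>*}"

definition site_box :: "int \<Rightarrow> int ^ 'd::finite \<Rightarrow> (int ^ 'd) set" where
  "site_box r b = {z. \<forall>i. \<bar>z $ i - b $ i\<bar> \<le> r}"

definition site :: "real ^ 'd::finite \<Rightarrow> int ^ 'd" where
  "site y = (\<chi> i. \<lfloor>y $ i\<rfloor>)"

definition centre :: "int ^ 'd::finite \<Rightarrow> real ^ 'd" where
  "centre z = (\<chi> i. of_int (z $ i) + 1/2)"

lemma site_nth [simp]: "site y $ i = \<lfloor>y $ i\<rfloor>"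
  by (simp add: site_def)

lemma centre_nth [simp]: "centre z $ i = of_int (z $ i) + 1/2"
  by (simp add: centre_def)

lemma site_centre [simp]: "site (centre z) = z"
  by (simp add: vec_eq_iff floor_eq_iff)

lemma axis_nth: "axis i x $ j = (if j = i then x else 0)"
  by (simp add: axis_def)

lemma mem_cube: "y \<in> cube l z \<longleftrightarrow> (\<forall>i. of_int (z $ i) \<le> y $ i \<and> y $ i \<le> of_int (z $ i) + of_nat l)"
  by (simp add: cube_def mem_box_cart)

lemma interior_cube: "interior (cube l z) = {y. \<forall>i. of_int (z $ i) < y $ i \<and> y $ i < of_int (z $ i) + of_nat l}"
  by (auto simp: cube_def interior_cbox mem_box_cart)

lemma centre_in_interior_cube: "centre z \<in> interior (cube 1 z)"
  by (simp add: interior_cube)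

lemma mem_cube_site: "y \<in> cube 1 (site y)"
  by (auto simp: mem_cube) 

lemma adjacent_sym: "adjacent z w \<Longrightarrow> adjacent w z"
  by (auto simp: adjacent_def)

lemma sym_link: "sym (link F)"
  by (auto simp: sym_def link_def intro: adjacent_sym)

lemma link_star_sym: "(z, w) \<in> (link F)\<^sup>* \<Longrightarrow> (w, z) \<in> (link F)\<^sup>*"
  using sym_rtrancl[OF sym_link] by (auto simp: sym_def)

lemma link_mono: "F \<subseteq> G \<Longrightarrow> link F \<subseteq> link G"
  by (auto simp: link_def)

lemma link_star_mono: "(z, w) \<in> (link F)\<^sup>* \<Longrightarrow> F \<subseteq> G \<Longrightarrow> (z, w) \<in> (link G)\<^sup>*"
  using rtrancl_mono[OF link_mono] by blast

lemma link_star_mem: "(z, w) \<in> (link F)\<^sup>* \<Longrightarrow> z \<in> F \<Longrightarrow> w \<in> F"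
  by (induction rule: rtrancl_induct) (auto simp: link_def)

lemma adjacent_diff_le: "adjacent z w \<Longrightarrow> \<bar>w $ i - z $ i\<bar> \<le> 1"
  by (auto simp: adjacent_def axis_nth)

text \<open>Changing one coordinate after the other by unit steps leads from \<open>a\<close> to \<open>b\<close> inside the
  lattice box that they span.\<close>
lemma link_star_between:
  fixes a b :: "int ^ 'd::finite"
  assumes "\<And>z. (\<And>i. min (a $ i) (b $ i) \<le> z $ i \<and> z $ i \<le> max (a $ i) (b $ i)) \<Longrightarrow> z \<in> F"
  shows "(a, b) \<in> (link F)\<^sup>*"
  using assms
proof (induction "\<Sum>i\<in>UNIV. nat \<bar>a $ i - b $ i\<bar>" arbitrary: a rule: less_induct)
  case less
  show ?case
  proof (cases "a = b")
    case False
    then obtain i where i: "a $ i \<noteq> b $ i" by (auto simp: vec_eq_iff)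
    define a' where "a' = (if a $ i < b $ i then a + axis i 1 else a - axis i 1)"
    have a'i: "a' $ i = (if a $ i < b $ i then a $ i + 1 else a $ i - 1)"
      by (simp add: a'_def axis_nth)
    have a'j: "a' $ j = a $ j" if "j \<noteq> i" for j
      using that by (simp add: a'_def axis_nth)
    have btw: "min (a $ j) (b $ j) \<le> a' $ j \<and> a' $ j \<le> max (a $ j) (b $ j)" for j
      using i a'i a'j[of j] by (cases "j = i") auto
    have "a \<in> F" by (rule less.prems) auto
    moreover have "a' \<in> F" using btw by (rule less.prems)
    moreover have "adjacent a a'" by (auto simp: adjacent_def a'_def)
    ultimately have "(a, a') \<in> link F" by (simp add: link_def)
    moreover have "(a', b) \<in> (link F)\<^sup>*"
    proof (rule less.hyps)
      show "(\<Sum>i\<in>UNIV. nat \<bar>a' $ i - b $ i\<bar>) < (\<Sum>i\<in>UNIV. nat \<bar>a $ i - b $ i\<bar>)"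
      proof (rule sum_strict_mono_ex1)
        show "\<forall>j\<in>UNIV. nat \<bar>a' $ j - b $ j\<bar> \<le> nat \<bar>a $ j - b $ j\<bar>"
        proof
          fix j show "nat \<bar>a' $ j - b $ j\<bar> \<le> nat \<bar>a $ j - b $ j\<bar>"
            using i a'i a'j[of j] by (cases "j = i") auto
        qed
        have "nat \<bar>a' $ i - b $ i\<bar> < nat \<bar>a $ i - b $ i\<bar>" using i a'i by auto
        then show "\<exists>j\<in>UNIV. nat \<bar>a' $ j - b $ j\<bar> < nat \<bar>a $ j - b $ j\<bar>" by blast
      qed simp
      fix z assume z: "\<And>j. min (a' $ j) (b $ j) \<le> z $ j \<and> z $ j \<le> max (a' $ j) (b $ j)"
      show "z \<in> F"
      proof (rule less.prems)
        fix j show "min (a $ j) (b $ j) \<le> z $ j \<and> z $ j \<le> max (a $ j) (b $ j)"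
          using z[of j] btw[of j] by linarith
      qed
    qed
    ultimately show ?thesis by (rule converse_rtrancl_into_rtrancl)
  qed simp
qed

text \<open>For \<open>I = UNIV\<close> and \<open>q = r\<close> this is a sphere of the maximum norm; for smaller \<open>I\<close> and \<open>q\<close> it is
  an annulus in the coordinate subspace through \<open>b\<close> spanned by \<open>I\<close>.\<close>
definition shell :: "'d set \<Rightarrow> int \<Rightarrow> int \<Rightarrow> int ^ 'd::finite \<Rightarrow> (int ^ 'd) set" where
  "shell I q r b =
     {z \<in> site_box r b. (\<forall>i. i \<notin> I \<longrightarrow> z $ i = b $ i) \<and> (\<exists>i\<in>I. q \<le> \<bar>z $ i - b $ i\<bar>)}"

text \<open>In dimension at least two one can walk in a shell from any site to a fixed corner: first push
  all coordinates but a large one to the corner value, then move the remaining one, another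
  coordinate being large by now.\<close>

lemma shell_connected:
  fixes b :: "int ^ 'd::finite"
  assumes I: "card I \<ge> 2" and q: "0 \<le> q" "q \<le> r" and z: "z \<in> shell I q r b" and w: "w \<in> shell I q r b"
  shows "(z, w) \<in> (link (shell I q r b))\<^sup>*"
proof -
  let ?S = "shell I q r b"
  define c where "c = (\<chi> i. if i \<in> I then b $ i + r else b $ i)"
  have key: "(z, c) \<in> (link ?S)\<^sup>*" if "z \<in> ?S" for z
  proof -
    obtain i where i: "i \<in> I" "q \<le> \<bar>z $ i - b $ i\<bar>" using \<open>z \<in> ?S\<close> by (auto simp: shell_def)
    have zb: "\<bar>z $ j - b $ j\<bar> \<le> r" for j using \<open>z \<in> ?S\<close> by (auto simp: shell_def site_box_def)
    have zI: "z $ j = b $ j" if "j \<notin> I" for j using \<open>z \<in> ?S\<close> that by (auto simp: shell_def)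
    have "I \<noteq> {i}" using I by auto
    then obtain j where j: "j \<noteq> i" "j \<in> I" using i by blast
    define e where "e = (\<chi> l. if l \<in> I \<and> l \<noteq> i then b $ l + r else z $ l)"
    have "(z, e) \<in> (link ?S)\<^sup>*"
    proof (rule link_star_between)
      fix y assume y: "\<And>l. min (z $ l) (e $ l) \<le> y $ l \<and> y $ l \<le> max (z $ l) (e $ l)"
      have "\<bar>y $ l - b $ l\<bar> \<le> r" for l
        using y[of l] zb[of l] q by (auto simp: e_def split: if_splits)
      moreover have "y $ l = b $ l" if "l \<notin> I" for l using y[of l] zI[of l] that by (simp add: e_def)
      moreover have "y $ i = z $ i" using y[of i] by (simp add: e_def)
      ultimately show "y \<in> ?S" using i by (auto simp: shell_def site_box_def intro!: bexI[of _ i])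
    qed
    moreover have "(e, c) \<in> (link ?S)\<^sup>*"
    proof (rule link_star_between)
      fix y assume y: "\<And>l. min (e $ l) (c $ l) \<le> y $ l \<and> y $ l \<le> max (e $ l) (c $ l)"
      have "\<bar>y $ l - b $ l\<bar> \<le> r" for l
        using y[of l] zb[of l] q by (auto simp: e_def c_def split: if_splits)
      moreover have "y $ l = b $ l" if "l \<notin> I" for l using y[of l] zI[of l] that by (simp add: e_def c_def)
      moreover have "y $ j = b $ j + r" using y[of j] j by (simp add: e_def c_def)
      ultimately show "y \<in> ?S" using q j by (auto simp: shell_def site_box_def intro!: bexI[of _ j])
    qed
    ultimately show ?thesis by (rule rtrancl_trans)
  qed
  show ?thesis using key[OF z] link_star_sym[OF key[OF w]] by (rule rtrancl_trans)
qed

abbreviation sphere_at :: "int \<Rightarrow> int ^ 'd::finite \<Rightarrow> (int ^ 'd) set" where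
  "sphere_at r \<equiv> shell UNIV r r"

lemma mem_sphere_at: "z \<in> sphere_at r b \<longleftrightarrow> z \<in> site_box r b \<and> z \<notin> site_box (r - 1) b"
  by (auto simp: shell_def site_box_def not_le not_less)

section \<open>Components are clusters of sites\<close>

lemma open_cubes_interior: "open (cubes_interior F)"
  by (simp add: cubes_interior_def)

lemma cubes_interior_mono: "F \<subseteq> G \<Longrightarrow> cubes_interior F \<subseteq> cubes_interior G"
  unfolding cubes_interior_def by (intro interior_mono) blast

lemma interior_cube_subset: "z \<in> F \<Longrightarrow> interior (cube 1 z) \<subseteq> cubes_interior F"
  unfolding cubes_interior_def by (intro interior_mono) blast

lemma open_coordinate_box:
  fixes y :: "real ^ 'd::finite"
  assumes "open U" "y \<in> U"
  obtains e where "e > 0" "\<And>x. (\<And>i. \<bar>x $ i - y $ i\<bar> < e) \<Longrightarrow> x \<in> U"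
proof -
  obtain r where r: "r > 0" "ball y r \<subseteq> U" using assms open_contains_ball by blast
  show ?thesis
  proof (rule that[of "r / CARD('d)"])
    show "r / CARD('d) > 0" using r by simp
    fix x assume x: "\<And>i. \<bar>x $ i - y $ i\<bar> < r / CARD('d)"
    have "norm (x - y) \<le> (\<Sum>i\<in>UNIV. \<bar>(x - y) $ i\<bar>)" by (rule norm_le_l1_cart)
    also have "\<dots> < (\<Sum>i\<in>(UNIV :: 'd set). r / CARD('d))"
      using x by (intro sum_strict_mono) auto
    also have "\<dots> = r" by simp
    finally show "x \<in> U" using r by (auto simp: dist_norm norm_minus_commute)
  qed
qed

text \<open>Points of an open set can be moved off the faces of the unit cubes: increasing all coordinates a
  little keeps the point in the set and brings it to the interior of the cube of its site.\<close>
lemma open_right_corner: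
  fixes y :: "real ^ 'd::finite"
  assumes "open U" "y \<in> U"
  obtains t where "t > 0" "\<And>i. y $ i + t < of_int (\<lfloor>y $ i\<rfloor>) + 1" 
    "\<And>x. (\<And>i. y $ i \<le> x $ i \<and> x $ i \<le> y $ i + t) \<Longrightarrow> x \<in> U"
proof -
  obtain e where e: "e > 0" "\<And>x. (\<And>i. \<bar>x $ i - y $ i\<bar> < e) \<Longrightarrow> x \<in> U"
    using open_coordinate_box[OF assms] by metis
  define m where "m = Min (range (\<lambda>i. of_int (\<lfloor>y $ i\<rfloor>) + 1 - y $ i))"
  have m: "m \<le> of_int (\<lfloor>y $ i\<rfloor>) + 1 - y $ i" for i
    unfolding m_def by (intro Min_le) auto
  have "0 < of_int (\<lfloor>y $ i\<rfloor>) + 1 - y $ i" for i by linarith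
  then have "m > 0" unfolding m_def by (subst Min_gr_iff) auto
  define t where "t = min e m / 2"
  have t: "t > 0" "t < e" "t < m" using \<open>e > 0\<close> \<open>m > 0\<close> by (auto simp: t_def min_def)
  show ?thesis
  proof (rule that[of t])
    show "y $ i + t < of_int (\<lfloor>y $ i\<rfloor>) + 1" for i using m[of i] t by linarith
    fix x assume x: "\<And>i. y $ i \<le> x $ i \<and> x $ i \<le> y $ i + t"
    show "x \<in> U"
    proof (rule e(2))
      fix i show "\<bar>x $ i - y $ i\<bar> < e" using x[of i] t by auto
    qed
  qed (use t in auto)
qed

text \<open>A point on a face belongs to several cubes, but the union of the cubes is a neighbourhood of it, so
  each of these cubes has to be present, in particular the one named by the floor function.\<close>
lemma site_of_cubes_interior:
  assumes "y \<in> cubes_interior F"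
  shows "site y \<in> F"
proof -
  obtain t where t: "t > 0" "\<And>i. y $ i + t < of_int (\<lfloor>y $ i\<rfloor>) + 1" 
    "\<And>x. (\<And>i. y $ i \<le> x $ i \<and> x $ i \<le> y $ i + t) \<Longrightarrow> x \<in> cubes_interior F"
    using open_right_corner[OF open_cubes_interior assms] by metis
  define x where "x = (\<chi> i. y $ i + t)"
  have "x \<in> cubes_interior F" using t(1) by (intro t(3)) (auto simp: x_def)
  then obtain z where z: "z \<in> F" "x \<in> cube 1 z"
    using interior_subset unfolding cubes_interior_def by blast
  have "z $ i = \<lfloor>y $ i\<rfloor>" for i
  proof -
    have "of_int (z $ i) \<le> y $ i + t" "y $ i + t \<le> of_int (z $ i) + 1"
      using z(2) by (auto simp: mem_cube x_def)
    moreover have "of_int \<lfloor>y $ i\<rfloor> < y $ i + t" using t(1) by linarith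
    ultimately show ?thesis using t(2)[of i] by linarith
  qed
  then have "z = site y" by (simp add: vec_eq_iff)
  then show ?thesis using z(1) by simp
qed

lemma connected_component_centre:
  assumes "y \<in> cubes_interior F"
  shows "connected_component (cubes_interior F) (centre (site y)) y"
proof -
  obtain t where t: "t > 0" "\<And>i. y $ i + t < of_int (\<lfloor>y $ i\<rfloor>) + 1" 
    "\<And>x. (\<And>i. y $ i \<le> x $ i \<and> x $ i \<le> y $ i + t) \<Longrightarrow> x \<in> cubes_interior F"
    using open_right_corner[OF open_cubes_interior assms] by metis
  define x where "x = (\<chi> i. y $ i + t)"
  let ?Q = "interior (cube 1 (site y))"
  have Q: "?Q \<subseteq> cubes_interior F" using interior_cube_subset site_of_cubes_interior assms by blast
  have xQ: "x \<in> ?Q" using t(1,2) 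
    by (auto simp: interior_cube x_def) (smt (verit) of_int_floor_le)+
  have "connected ?Q" by (simp add: cube_def interior_cbox convex_connected)
  then have 1: "connected_component (cubes_interior F) (centre (site y)) x"
    using Q xQ centre_in_interior_cube connected_component_def by blast
  have "cbox y x \<subseteq> cubes_interior F"
    by (auto intro!: t(3) simp: mem_box_cart x_def)
  moreover have "connected (cbox y x)" by (simp add: convex_connected)
  moreover have "y \<in> cbox y x" "x \<in> cbox y x" using t(1) by (auto simp: mem_box_cart x_def)
  ultimately have "connected_component (cubes_interior F) x y"
    unfolding connected_component_def by blast
  with 1 show ?thesis by (rule connected_component_trans)
qed

text \<open>The two cubes share a face whose relative interior lies in the interior of their union.\<close>
lemma connected_component_adjacent:
  assumes "(z, w) \<in> link F"
  shows "connected_component (cubes_interior F) (centre z) (centre w)"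
proof -
  have *: "connected_component (cubes_interior F) (centre z) (centre w)"
    if zw: "z \<in> F" "w \<in> F" "w = z + axis i 1" for z w :: "int ^ 'a" and i
  proof -
    define Q where "Q = box (\<chi> j. real_of_int (z $ j)) (\<chi> j. of_int (w $ j) + 1)"
    have "Q \<subseteq> (\<Union>z\<in>F. cube 1 z)"
    proof
      fix y assume y: "y \<in> Q"
      show "y \<in> (\<Union>z\<in>F. cube 1 z)"
      proof (cases "y $ i \<le> of_int (z $ i) + 1")
        case True
        have "y \<in> cube 1 z" unfolding mem_cube
        proof
          fix j show "real_of_int (z $ j) \<le> y $ j \<and> y $ j \<le> real_of_int (z $ j) + real 1"
            using y True by (auto simp: Q_def mem_box_cart zw(3) axis_nth dest: spec[of _ j] split: if_splits)
        qed
        then show ?thesis using zw by blast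
      next
        case False
        have "y \<in> cube 1 w" unfolding mem_cube
        proof
          fix j show "real_of_int (w $ j) \<le> y $ j \<and> y $ j \<le> real_of_int (w $ j) + real 1"
            using y False by (auto simp: Q_def mem_box_cart zw(3) axis_nth dest: spec[of _ j] split: if_splits)
        qed
        then show ?thesis using zw by blast
      qed
    qed
    moreover have "open Q" by (simp add: Q_def open_box)
    ultimately have "Q \<subseteq> cubes_interior F"
      unfolding cubes_interior_def by (rule interior_maximal)
    moreover have "connected Q" by (simp add: Q_def convex_connected)
    moreover have "centre z \<in> Q" "centre w \<in> Q"
      by (auto simp: Q_def mem_box_cart zw(3) axis_nth)
    ultimately show ?thesis unfolding connected_component_def by blast
  qed
  have zw: "z \<in> F" "w \<in> F" "adjacent z w" using assms by (auto simp: link_def)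
  from zw(3) obtain i where "w = z + axis i 1 \<or> z = w + axis i 1"
    unfolding adjacent_def by (metis diff_add_cancel)
  then show ?thesis using *[of z w i] *[of w z i] zw connected_component_sym by blast
qed

lemma connected_component_link:
  assumes "(z, w) \<in> (link F)\<^sup>*" "z \<in> F"
  shows "connected_component (cubes_interior F) (centre z) (centre w)"
  using assms(1)
proof (induction rule: rtrancl_induct)
  case base
  then show ?case using interior_cube_subset[OF assms(2)] centre_in_interior_cube[of z]
    by (auto simp: connected_component_refl_eq)
next
  case (step y z)
  then show ?case using connected_component_adjacent connected_component_trans by blast
qed

text \<open>Along a connected set the cluster of the site of a point is locally constant: the sites of
  two nearby points differ by at most one in each coordinate, and every site between them is the
  site of a third nearby point.\<close>

lemma link_of_connected:
  assumes C: "connected C" "C \<subseteq> cubes_interior F" and "x \<in> C" "y \<in> C"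
  shows "(site x, site y) \<in> (link F)\<^sup>*"
proof (rule connected_equivalence_relation[OF C(1) assms(3,4)])
  fix y assume y: "y \<in> C"
  obtain e where e: "e > 0" "\<And>x. (\<And>i. \<bar>x $ i - y $ i\<bar> < e) \<Longrightarrow> x \<in> cubes_interior F"
    using open_coordinate_box[OF open_cubes_interior] y C(2) by (metis subsetD)
  define T where "T = C \<inter> ball y (min e 1)"
  have "(site y, site x) \<in> (link F)\<^sup>*" if "x \<in> T" for x
  proof (rule link_star_between)
    have xy: "\<bar>x $ i - y $ i\<bar> < min e 1" for i
    proof -
      have "\<bar>(x - y) $ i\<bar> \<le> norm (x - y)" by (rule component_le_norm_cart)
      also have "\<dots> < min e 1" using that by (simp add: T_def dist_norm norm_minus_commute)
      finally show ?thesis by simp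
    qed
    fix z assume z: "\<And>i. min (site y $ i) (site x $ i) \<le> z $ i \<and> z $ i \<le> max (site y $ i) (site x $ i)"
    define u where "u = (\<chi> i. if z $ i = \<lfloor>y $ i\<rfloor> then y $ i else x $ i)"
    have "u \<in> cubes_interior F"
    proof (rule e(2))
      fix i show "\<bar>u $ i - y $ i\<bar> < e" using xy[of i] e(1) by (auto simp: u_def)
    qed
    moreover have "z = site u"
    proof -
      have "z $ i = \<lfloor>u $ i\<rfloor>" for i
      proof -
        have "\<bar>\<lfloor>x $ i\<rfloor> - \<lfloor>y $ i\<rfloor>\<bar> \<le> 1" using xy[of i] by linarith
        then show ?thesis using z[of i] by (auto simp: u_def)
      qed
      then show ?thesis by (simp add: vec_eq_iff)
    qed
    ultimately show "z \<in> F" using site_of_cubes_interior by blast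
  qed
  moreover have "openin (top_of_set C) T" by (simp add: T_def openin_open_Int)
  moreover have "y \<in> T" using y e(1) by (simp add: T_def)
  ultimately show "\<exists>T. openin (top_of_set C) T \<and> y \<in> T \<and> (\<forall>x\<in>T. (site y, site x) \<in> (link F)\<^sup>*)" by blast
qed (auto intro: link_star_sym rtrancl_trans)

lemma cluster_subset: "cluster F z \<subseteq> F" by (auto simp: cluster_def)

lemma self_in_cluster: "z \<in> F \<Longrightarrow> z \<in> cluster F z" by (simp add: cluster_def)

text \<open>Cubes that meet only in a face of codimension at least two are not joined through that face, since
  its points are interior to the union only when all cubes around it are present. Hence topological
  connection in the open set is the same as connection of sites by face adjacency.\<close>
lemma component_eq_cluster:
  assumes z: "z \<in> F"
  shows "connected_component_set (cubes_interior F) (centre z) = cubes_interior (cluster F z)"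
proof
  let ?C = "connected_component_set (cubes_interior F) (centre z)"
  have c: "centre z \<in> cubes_interior F"
    using interior_cube_subset[OF z] centre_in_interior_cube[of z] by auto
  have "?C \<subseteq> (\<Union>z\<in>cluster F z. cube 1 z)"
  proof
    fix y assume y: "y \<in> ?C"
    then have yF: "y \<in> cubes_interior F" using connected_component_subset by blast
    have "(site (centre z), site y) \<in> (link F)\<^sup>*"
      by (rule link_of_connected[of ?C]) (use y c in \<open>auto simp: connected_component_subset connected_component_refl_eq\<close>)
    then have "site y \<in> cluster F z" using site_of_cubes_interior[OF yF] by (simp add: cluster_def)
    then show "y \<in> (\<Union>z\<in>cluster F z. cube 1 z)" using mem_cube_site by blast
  qed
  moreover have "open ?C" by (simp add: open_connected_component open_cubes_interior)
  ultimately show "?C \<subseteq> cubes_interior (cluster F z)"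
    unfolding cubes_interior_def by (rule interior_maximal)
  show "cubes_interior (cluster F z) \<subseteq> ?C"
  proof
    fix y assume y: "y \<in> cubes_interior (cluster F z)"
    then have yF: "y \<in> cubes_interior F" using cubes_interior_mono[OF cluster_subset] by blast
    from y have "site y \<in> cluster F z" by (rule site_of_cubes_interior)
    then have "connected_component (cubes_interior F) (centre z) (centre (site y))"
      by (intro connected_component_link z) (simp add: cluster_def)
    from connected_component_trans[OF this connected_component_centre[OF yF]] show "y \<in> ?C" by simp
  qed
qed

lemma centre_in_cubes_interior: "centre z \<in> cubes_interior F \<longleftrightarrow> z \<in> F"
  using site_of_cubes_interior[of "centre z" F] interior_cube_subset[of z F] centre_in_interior_cube[of z]
  by auto

lemma components_cubes_interior:
  "components (cubes_interior F) = (\<lambda>z. cubes_interior (cluster F z)) ` F"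
proof -
  have "connected_component_set (cubes_interior F) y = cubes_interior (cluster F (site y))"
    if "y \<in> cubes_interior F" for y
    using connected_component_eq[of y "cubes_interior F" "centre (site y)"] connected_component_centre[OF that]
      component_eq_cluster[OF site_of_cubes_interior[OF that]] by auto
  note * = this
  show ?thesis
  proof (intro equalityI subsetI)
    fix C assume "C \<in> components (cubes_interior F)"
    then obtain y where "y \<in> cubes_interior F" "C = connected_component_set (cubes_interior F) y"
      by (auto simp: components_def)
    then show "C \<in> (\<lambda>z. cubes_interior (cluster F z)) ` F"
      using * site_of_cubes_interior by blast
  next
    fix C assume "C \<in> (\<lambda>z. cubes_interior (cluster F z)) ` F"
    then obtain z where "z \<in> F" "C = cubes_interior (cluster F z)" by blast
    then show "C \<in> components (cubes_interior F)"
      using component_eq_cluster[of z F] centre_in_cubes_interior[of z F] by (auto simp: components_def)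
  qed
qed

lemma cubes_in_cubes_interior: "cubes_in (cubes_interior F) = F"
proof -
  have "z \<in> F" if "interior (cube 1 z) \<subseteq> cubes_interior F" for z
    using that centre_in_interior_cube[of z] centre_in_cubes_interior[of z F] by blast
  then show ?thesis using interior_cube_subset by (auto simp: cubes_in_def)
qed

lemma cluster_cong:
  assumes z: "z \<in> F"
    and eq: "\<And>w. w \<in> cluster F z \<or> (\<exists>v\<in>cluster F z. adjacent v w) \<Longrightarrow> w \<in> F \<longleftrightarrow> w \<in> F'"
  shows "cluster F' z = cluster F z"
proof -
  have "w \<in> cluster F z" if "(z, w) \<in> (link F')\<^sup>*" for w
    using that
  proof (induction rule: rtrancl_induct)
    case (step y w)
    then have w: "w \<in> F'" "adjacent y w" by (auto simp: link_def)
    then have "w \<in> F" using eq[of w] step.IH by blast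
    then have "(y, w) \<in> link F" using w step.IH by (auto simp: link_def cluster_def)
    with step.IH show ?case
      using \<open>w \<in> F\<close> rtrancl_into_rtrancl[of z y "link F" w] by (simp add: cluster_def)
  qed (use z in \<open>simp add: self_in_cluster\<close>)
  moreover have "(z, w) \<in> (link F')\<^sup>*" if "(z, w) \<in> (link F)\<^sup>*" for w
    using that
  proof (induction rule: rtrancl_induct)
    case (step y w)
    have "(z, w) \<in> (link F)\<^sup>*" using step.hyps by (rule rtrancl_into_rtrancl)
    then have "y \<in> cluster F z" "w \<in> cluster F z"
      using step.hyps link_star_mem[OF _ z] by (auto simp: cluster_def)
    then have "(y, w) \<in> link F'" using step.hyps(2) eq[of y] eq[of w] cluster_subset by (auto simp: link_def)
    then show ?case using step.IH by (rule rtrancl_into_rtrancl[rotated])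
  qed simp
  ultimately show ?thesis using eq unfolding cluster_def by blast
qed

section \<open>Components inside a window\<close>

lemma components_Union_components:
  assumes "\<C> \<subseteq> components X"
  shows "components (\<Union>\<C>) = \<C>"
proof (intro equalityI subsetI)
  have UX: "\<Union>\<C> \<subseteq> X" using assms in_components_subset by blast
  {
    fix D assume D: "D \<in> components (\<Union>\<C>)"
    then have D': "D \<noteq> {}" "connected D" "D \<subseteq> \<Union>\<C>"
      using in_components_nonempty in_components_connected in_components_subset by blast+
    then obtain C where C: "C \<in> \<C>" "C \<inter> D \<noteq> {}" by blast
    have "D \<subseteq> C" 
      using components_maximal[of C X D] assms C D' UX by blast
    moreover have "C \<subseteq> D"
      using components_maximal[OF D, of C] C assms in_components_connected by (metis Int_commute Sup_upper subsetD)
    ultimately show "D \<in> \<C>" using C by simp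
  }
  fix C assume C: "C \<in> \<C>"
  then have "C \<in> components X" using assms by blast
  then have *: "C \<noteq> {}" "connected C" "\<And>d. d \<noteq> {} \<Longrightarrow> C \<subseteq> d \<Longrightarrow> d \<subseteq> X \<Longrightarrow> connected d \<Longrightarrow> d = C"
    by (auto simp: in_components_maximal)
  have "d = C" if "d \<noteq> {}" "C \<subseteq> d" "d \<subseteq> \<Union>\<C>" "connected d" for d
    using that UX by (intro *(3)) blast+
  then show "C \<in> components (\<Union>\<C>)"
    using C * by (simp add: in_components_maximal Sup_upper)
qed

lemma components_black_region_in:
  "components (black_region_in L \<omega>) = {C \<in> components (black_region \<omega>). C \<subseteq> window L}"
  unfolding black_region_in_def by (rule components_Union_components) blast

text \<open>The sites whose cubes lie in the window.\<close>
definition window_sites :: "nat \<Rightarrow> (int ^ 'd::finite) set" where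
  "window_sites L = {z. \<forall>i. - (int L div 2) \<le> z $ i \<and> z $ i < int L - int L div 2}"

lemma floor_half: "\<lfloor>real L / 2\<rfloor> = int L div 2" 
  by (metis floor_divide_of_nat_eq of_nat_numeral zdiv_int)

lemma ceiling_half: "\<lceil>real L / 2\<rceil> = int L - int L div 2" 
  using floor_half[of L] by linarith

lemma mem_window:
  "y \<in> window L \<longleftrightarrow> (\<forall>i. - of_int (int L div 2) \<le> y $ i \<and> y $ i \<le> of_int (int L - int L div 2))"
  by (simp add: window_def mem_box_cart floor_half ceiling_half)

lemma centre_in_window: "centre z \<in> window L \<longleftrightarrow> z \<in> window_sites L"
proof -
  have "(- of_int (int L div 2) \<le> (of_int a + 1/2 :: real) \<and> (of_int a + 1/2 :: real) \<le> of_int (int L - int L div 2))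
     \<longleftrightarrow> - (int L div 2) \<le> a \<and> a < int L - int L div 2" for a :: int
    by linarith
  then show ?thesis unfolding mem_window window_sites_def by simp
qed

lemma card_int_interval_vec:
  "card {z :: int ^ 'd::finite. \<forall>i. a \<le> z $ i \<and> z $ i < b} = nat (b - a) ^ CARD('d)"
  "finite {z :: int ^ 'd::finite. \<forall>i. a \<le> z $ i \<and> z $ i < b}"
proof -
  let ?A = "Pi\<^sub>E (UNIV :: 'd set) (\<lambda>_. {a..<b})"
  have bij: "bij_betw vec_lambda ?A {z :: int ^ 'd::finite. \<forall>i. a \<le> z $ i \<and> z $ i < b}"
    by (rule bij_betwI[of _ _ _ vec_nth]) (auto simp: PiE_def)
  show "card {z :: int ^ 'd::finite. \<forall>i. a \<le> z $ i \<and> z $ i < b} = nat (b - a) ^ CARD('d)"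
    using bij_betw_same_card[OF bij] by (simp add: card_PiE)
  show "finite {z :: int ^ 'd::finite. \<forall>i. a \<le> z $ i \<and> z $ i < b}"
    using bij_betw_finite[OF bij] by (simp add: finite_PiE)
qed

lemma card_window_sites: "card (window_sites L :: (int ^ 'd::finite) set) = L ^ CARD('d)"
  and finite_window_sites: "finite (window_sites L :: (int ^ 'd::finite) set)"
  unfolding window_sites_def using card_int_interval_vec[of "- (int L div 2)" "int L - int L div 2"]
  by simp_all

lemma site_box_interval: "site_box r b = (\<lambda>z. z + b) ` {z. \<forall>i. - r \<le> z $ i \<and> z $ i < r + 1}"
proof (intro equalityI subsetI)
  fix z assume "z \<in> site_box r b"
  then have "z = (z - b) + b" "z - b \<in> {z. \<forall>i. - r \<le> z $ i \<and> z $ i < r + 1}"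
    by (auto simp: site_box_def abs_le_iff) (smt (verit))+
  then show "z \<in> (\<lambda>z. z + b) ` {z. \<forall>i. - r \<le> z $ i \<and> z $ i < r + 1}" by blast
qed (auto simp: site_box_def abs_le_iff, smt (verit))

lemma card_site_box: "card (site_box r b :: (int ^ 'd::finite) set) = nat (2 * r + 1) ^ CARD('d)"
  and finite_site_box: "finite (site_box r b :: (int ^ 'd::finite) set)"
proof -
  show "card (site_box r b :: (int ^ 'd::finite) set) = nat (2 * r + 1) ^ CARD('d)"
    unfolding site_box_interval
    by (subst card_image) (auto simp: inj_on_def card_int_interval_vec algebra_simps)
  show "finite (site_box r b :: (int ^ 'd::finite) set)"
    unfolding site_box_interval by (intro finite_imageI card_int_interval_vec)
qed

lemma components_in_window:
  "{C \<in> components (cubes_interior F). C \<subseteq> window L} =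
    (\<lambda>z. cubes_interior (cluster F z)) ` {z \<in> F. cubes_interior (cluster F z) \<subseteq> window L}"
  by (auto simp: components_cubes_interior)

lemma cluster_in_window:
  assumes "cubes_interior (cluster F z) \<subseteq> window L"
  shows "cluster F z \<subseteq> window_sites L"
  using assms centre_in_window centre_in_cubes_interior by blast

lemma finite_components_black_region_in: "finite (components (black_region_in L \<omega>))"
  and b0_le: "b0 L (\<omega> :: int ^ 'd::finite \<Rightarrow> bool) \<le> L ^ CARD('d)"
proof -
  let ?F = "{z. \<omega> z}"
  let ?I = "{z \<in> ?F. cubes_interior (cluster ?F z) \<subseteq> window L}"
  have sub: "?I \<subseteq> window_sites L"
    using cluster_in_window self_in_cluster by blast
  then have fin: "finite ?I" using finite_window_sites finite_subset by blast
  have eq: "components (black_region_in L \<omega>) = (\<lambda>z. cubes_interior (cluster ?F z)) ` ?I"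
    unfolding components_black_region_in black_region_def components_in_window ..
  show "finite (components (black_region_in L \<omega>))" unfolding eq using fin by simp
  have "b0 L \<omega> \<le> card ?I" unfolding b0_def eq using fin by (rule card_image_le)
  also have "\<dots> \<le> card (window_sites L :: (int ^ 'd) set)"
    using sub finite_window_sites by (intro card_mono) auto
  finally show "b0 L \<omega> \<le> L ^ CARD('d)" by (simp add: card_window_sites)
qed

text \<open>Membership of a component in the window, and maximality of a cluster there, can be read off from the
  window and the layer of sites around it. This makes every event about the empirical law
  measurable.\<close>
lemma black_region_in_cong:
  fixes \<omega> \<omega>' :: "int ^ 'd::finite \<Rightarrow> bool"
  assumes "\<And>z. (\<exists>v\<in>window_sites L. \<forall>i. \<bar>z $ i - v $ i\<bar> \<le> 1) \<Longrightarrow> \<omega> z = \<omega>' z"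
  shows "black_region_in L \<omega> = black_region_in L \<omega>'"
proof -
  have *: "\<exists>z'\<in>F'. cubes_interior (cluster F' z') = cubes_interior (cluster F z)"
    if F: "\<And>z. (\<exists>v\<in>window_sites L. \<forall>i. \<bar>z $ i - v $ i\<bar> \<le> 1) \<Longrightarrow> z \<in> F \<longleftrightarrow> z \<in> F'"
      and z: "z \<in> F" "cubes_interior (cluster F z) \<subseteq> window L"
    for F F' :: "(int ^ 'd) set" and z
  proof
    have sub: "cluster F z \<subseteq> window_sites L" using cluster_in_window z by blast
    have "w \<in> F \<longleftrightarrow> w \<in> F'" if w: "w \<in> cluster F z \<or> (\<exists>v\<in>cluster F z. adjacent v w)" for w
    proof (rule F)
      from w obtain v where "v \<in> cluster F z" "v = w \<or> adjacent v w" by blast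
      then show "\<exists>v\<in>window_sites L. \<forall>i. \<bar>w $ i - v $ i\<bar> \<le> 1"
        using sub adjacent_diff_le[of v w] by (intro bexI[of _ v]) auto
    qed
    then show "cubes_interior (cluster F' z) = cubes_interior (cluster F z)"
      using cluster_cong[OF z(1)] by metis
    have "z \<in> window_sites L" using sub self_in_cluster[OF z(1)] by blast
    then show "z \<in> F'" using F[of z] z(1) by force
  qed
  have **: "{C \<in> components (cubes_interior F). C \<subseteq> window L} \<subseteq> {C \<in> components (cubes_interior F'). C \<subseteq> window L}"
    if "\<And>z. (\<exists>v\<in>window_sites L. \<forall>i. \<bar>z $ i - v $ i\<bar> \<le> 1) \<Longrightarrow> z \<in> F \<longleftrightarrow> z \<in> F'"
    for F F' :: "(int ^ 'd) set"
    using *[OF that] by (fastforce simp: components_cubes_interior image_iff)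
  have "{C \<in> components (black_region \<omega>). C \<subseteq> window L} = {C \<in> components (black_region \<omega>'). C \<subseteq> window L}"
    unfolding black_region_def
    using **[of "{z. \<omega> z}" "{z. \<omega>' z}"] **[of "{z. \<omega>' z}" "{z. \<omega> z}"] assms by auto
  then show ?thesis unfolding black_region_in_def by simp
qed

section \<open>Spheres separated by maps to a sphere\<close>

lemma infinite_order_of_iso_integer_group:
  assumes "integer_group \<cong> H" "group H"
  obtains u where "u \<in> carrier H" "\<And>n :: int. u [^]\<^bsub>H\<^esub> n = \<one>\<^bsub>H\<^esub> \<Longrightarrow> n = 0"
proof -
  obtain h where h: "h \<in> iso integer_group H" using assms by (auto simp: is_iso_def)
  interpret group_hom integer_group H h
    using h assms by (intro group_hom.intro group_hom_axioms.intro) (auto simp: iso_def)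
  have inj: "inj h" using h by (auto simp: iso_def bij_betw_def)
  show ?thesis
  proof (rule that[of "h 1"])
    show "h 1 \<in> carrier H" by (rule hom_closed) simp
    fix n :: int assume "h 1 [^]\<^bsub>H\<^esub> n = \<one>\<^bsub>H\<^esub>"
    then have "h (1 [^]\<^bsub>integer_group\<^esub> n) = h \<one>\<^bsub>integer_group\<^esub>"
      using hom_int_pow[of 1 n] hom_one by simp
    then show "n = 0" using inj by (auto dest: injD)
  qed
qed

lemma nsphere_infinite_order:
  assumes "k > 0"
  obtains u where "u \<in> carrier (homology_group (int k) (nsphere k))"
    "\<And>n :: int. u [^]\<^bsub>homology_group (int k) (nsphere k)\<^esub> n = \<one>\<^bsub>homology_group (int k) (nsphere k)\<^esub> \<Longrightarrow> n = 0"
proof -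
  let ?H = "homology_group (int k) (nsphere k)"
  have "reduced_homology_group (int k) (nsphere k) = ?H"
    using assms by (simp add: un_reduced_homology_group)
  then have "integer_group \<cong> ?H"
    using reduced_homology_group_nsphere(1)[of k] group.iso_sym[OF group_reduced_homology_group] by metis
  then show ?thesis
    using infinite_order_of_iso_integer_group[OF _ group_relative_homology_group] that by blast
qed

text \<open>A constant map factors through a point, whose homology in degree \<open>p\<close> is trivial.\<close>
lemma hom_induced_const:
  assumes "p \<noteq> 0" "a \<in> topspace Y" and c: "c \<in> carrier (homology_group p X)"
  shows "hom_induced p X {} Y {} (\<lambda>_. a) c = \<one>\<^bsub>homology_group p Y\<^esub>"
proof -
  let ?P = "subtopology Y {a}"
  have P: "topspace ?P = {a}" using assms by auto
  have cont: "continuous_map X ?P (\<lambda>_. a)" "continuous_map ?P Y id"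
    using assms by (auto simp: continuous_map_in_subtopology continuous_map_from_subtopology)
  have "hom_induced p X {} ?P {} (\<lambda>_. a) c \<in> carrier (homology_group p ?P)"
    by (rule hom_in_carrier[OF hom_induced_empty_hom c])
  then have 1: "hom_induced p X {} ?P {} (\<lambda>_. a) c = \<one>\<^bsub>homology_group p ?P\<^esub>"
    using homology_dimension_axiom[OF P assms(1)] by (auto simp: trivial_group_def)
  have "hom_induced p X {} Y {} (id \<circ> (\<lambda>_. a)) c = hom_induced p ?P {} Y {} id (hom_induced p X {} ?P {} (\<lambda>_. a) c)"
    by (subst hom_induced_compose_empty[OF cont]) simp
  also have "\<dots> = \<one>\<^bsub>homology_group p Y\<^esub>" unfolding 1
    by (rule hom_one[OF hom_induced_empty_hom]) auto
  finally show ?thesis by (simp add: comp_def)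
qed

lemma hom_finprod:
  assumes "comm_group G" "comm_group H" "h \<in> hom G H" "finite A" "f \<in> A \<rightarrow> carrier G"
  shows "h (finprod G f A) = finprod H (\<lambda>x. h (f x)) A"
proof -
  interpret G: comm_group G by fact
  interpret H: comm_group H by fact
  interpret h: group_hom G H h
    using assms by unfold_locales
  show ?thesis using assms(4,5)
  proof (induction A rule: finite_induct)
    case (insert x A)
    have "f \<in> A \<rightarrow> carrier G" "f x \<in> carrier G" "(\<lambda>x. h (f x)) \<in> A \<rightarrow> carrier H"
      using insert.prems h.hom_closed by (auto intro: h.hom_closed)
    then show ?case using insert
      by (simp add: G.finprod_insert H.finprod_insert G.finprod_closed)
  qed simp
qed

text \<open>Applying \<open>F i\<close> to a relation between the \<open>e j\<close> leaves the power of \<open>u\<close> whose exponent is the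
  \<open>i\<close>-th coefficient.\<close>
lemma Z_independent_of_dual_family:
  assumes G: "comm_group G" and H: "comm_group H" and B: "finite B"
    and F: "\<And>i. i \<in> B \<Longrightarrow> F i \<in> hom G H"
    and e: "\<And>i. i \<in> B \<Longrightarrow> e i \<in> carrier G"
    and u: "u \<in> carrier H" "\<And>n :: int. u [^]\<^bsub>H\<^esub> n = \<one>\<^bsub>H\<^esub> \<Longrightarrow> n = 0"
    and Fe: "\<And>i. i \<in> B \<Longrightarrow> F i (e i) = u"
    and Fe0: "\<And>i j. i \<in> B \<Longrightarrow> j \<in> B \<Longrightarrow> i \<noteq> j \<Longrightarrow> F i (e j) = \<one>\<^bsub>H\<^esub>"
  shows "Z_independent G (e ` B)" "card (e ` B) = card B"
proof -
  interpret G: comm_group G by fact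
  interpret H: comm_group H by fact
  have u1: "u \<noteq> \<one>\<^bsub>H\<^esub>" using u(2)[of 1] u(1) by auto
  have inj: "inj_on e B"
    by (rule inj_onI) (metis Fe Fe0 u1)
  then show "card (e ` B) = card B" by (rule card_image)
  show "Z_independent G (e ` B)"
    unfolding Z_independent_def
  proof (intro conjI allI impI ballI)
    show "e ` B \<subseteq> carrier G" using e by auto
    show "finite (e ` B)" using B by simp
    fix c :: "_ \<Rightarrow> int" and b
    assume c: "finprod G (\<lambda>b. b [^]\<^bsub>G\<^esub> c b) (e ` B) = \<one>\<^bsub>G\<^esub>" and "b \<in> e ` B"
    then obtain i where i: "i \<in> B" "b = e i" by blast
    interpret Fi: group_hom G H "F i"
      using F[OF i(1)] by unfold_locales
    have "\<one>\<^bsub>H\<^esub> = F i (finprod G (\<lambda>b. b [^]\<^bsub>G\<^esub> c b) (e ` B))" by (simp add: c)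
    also have "finprod G (\<lambda>b. b [^]\<^bsub>G\<^esub> c b) (e ` B) = finprod G (\<lambda>j. e j [^]\<^bsub>G\<^esub> c (e j)) B"
      using e inj by (subst G.finprod_reindex) auto
    also have "F i \<dots> = finprod H (\<lambda>j. F i (e j [^]\<^bsub>G\<^esub> c (e j))) B"
      using e B F i(1) by (intro hom_finprod G H) auto
    also have "\<dots> = finprod H (\<lambda>j. if i = j then u [^]\<^bsub>H\<^esub> c (e j) else \<one>\<^bsub>H\<^esub>) B"
      using e i Fe Fe0 u(1) by (intro H.finprod_cong') (auto simp: Fi.hom_int_pow)
    also have "\<dots> = u [^]\<^bsub>H\<^esub> c (e i)"
      using B i u(1) by (subst H.finprod_singleton) auto
    finally show "c b = 0" using u(2) i by metis
  qed
qed

text \<open>A family of spheres in \<open>C\<close> that is separated by maps of \<open>C\<close> to the sphere: on homology the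
  \<open>i\<close>-th map sends the class of the \<open>i\<close>-th sphere to an element of infinite order and kills the others, so the
  classes are linearly independent.\<close>

lemma card_le_betti:
  fixes C :: "'a::topological_space set"
  assumes k: "k > 0" and B: "finite B"
    and f: "\<And>i. i \<in> B \<Longrightarrow> continuous_map (top_of_set C) (nsphere k) (f i)"
    and g: "\<And>i. i \<in> B \<Longrightarrow> continuous_map (nsphere k) (top_of_set C) (g i)"
    and fg: "\<And>i x. i \<in> B \<Longrightarrow> x \<in> topspace (nsphere k) \<Longrightarrow> f i (g i x) = x"
    and fg0: "\<And>i j x. i \<in> B \<Longrightarrow> j \<in> B \<Longrightarrow> i \<noteq> j \<Longrightarrow> x \<in> topspace (nsphere k) \<Longrightarrow> f i (g j x) = a"
    and a: "a \<in> topspace (nsphere k)"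
  shows "enat (card B) \<le> betti k C"
proof -
  let ?S = "nsphere k" and ?X = "top_of_set C"
  let ?HS = "homology_group (int k) ?S" and ?HX = "homology_group (int k) ?X"
  let ?F = "\<lambda>i. hom_induced (int k) ?X {} ?S {} (f i)"
  obtain u where u: "u \<in> carrier ?HS" "\<And>n :: int. u [^]\<^bsub>?HS\<^esub> n = \<one>\<^bsub>?HS\<^esub> \<Longrightarrow> n = 0"
    using nsphere_infinite_order[OF k] by blast
  define e where "e i = hom_induced (int k) ?S {} ?X {} (g i) u" for i
  have comp: "?F i (e j) = hom_induced (int k) ?S {} ?S {} (f i \<circ> g j) u" if "i \<in> B" "j \<in> B" for i j
    unfolding e_def using that by (subst hom_induced_compose_empty[OF g f]) auto
  have Fe: "?F i (e i) = u" if "i \<in> B" for i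
  proof -
    have "hom_induced (int k) ?S {} ?S {} (f i \<circ> g i) u = hom_induced (int k) ?S {} ?S {} id u"
      using fg[OF that] by (intro fun_cong[OF hom_induced_eq]) simp
    then show ?thesis using comp[OF that that] u(1) by (simp add: hom_induced_id)
  qed
  have Fe0: "?F i (e j) = \<one>\<^bsub>?HS\<^esub>" if "i \<in> B" "j \<in> B" "i \<noteq> j" for i j
  proof -
    have "hom_induced (int k) ?S {} ?S {} (f i \<circ> g j) u = hom_induced (int k) ?S {} ?S {} (\<lambda>_. a) u"
      using fg0[OF that] by (intro fun_cong[OF hom_induced_eq]) simp
    also have "\<dots> = \<one>\<^bsub>?HS\<^esub>" using a k u(1) by (intro hom_induced_const) auto
    finally show ?thesis using comp[OF that(1,2)] by simp
  qed
  note * = Z_independent_of_dual_family[where F = ?F and e = e, OF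
    abelian_homology_group abelian_homology_group B hom_induced_empty_hom _ u Fe Fe0]
  have e: "e i \<in> carrier ?HX" for i
    unfolding e_def by (rule hom_in_carrier[OF hom_induced_empty_hom u(1)])
  have "enat (card (e ` B)) \<le> abelian_rank ?HX"
    unfolding abelian_rank_def using *(1) e by (intro SUP_upper) auto
  then show ?thesis using *(2) e by (simp add: betti_def)
qed

section \<open>Gadgets\<close>

lemma nsphere_top_of_set:
  "nsphere k = top_of_set {x :: nat \<Rightarrow> real. (\<Sum>j\<le>k. (x j)\<^sup>2) = 1 \<and> (\<forall>j>k. x j = 0)}"
  by (simp add: nsphere euclidean_product_topology)

text \<open>The coordinates \<open>\<sigma> 0, \<dots>, \<sigma> k\<close> span a \<open>(k+1)\<close>-dimensional slab of unit thickness around \<open>b\<close>.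
  The ring is the part of this slab within distance \<open>k + 2\<close> of \<open>b\<close>, with the cube of \<open>b\<close>
  removed, hence a thickened \<open>k\<close>-sphere. All other sites within distance \<open>k + 3\<close> are white,
  apart from the tube site next to the ring, through which the ring is connected to the
  black hull at distance \<open>k + 4\<close>. The width of the ring leaves room for a Euclidean
  sphere of radius \<open>k + 1\<close>, which avoids the cube of \<open>b\<close>.\<close>
definition tube_site :: "(nat \<Rightarrow> 'd::finite) \<Rightarrow> nat \<Rightarrow> int ^ 'd \<Rightarrow> int ^ 'd" where
  "tube_site \<sigma> k b = b + axis (\<sigma> 0) (int k + 3)"

definition ring_sites :: "(nat \<Rightarrow> 'd::finite) \<Rightarrow> nat \<Rightarrow> int ^ 'd \<Rightarrow> (int ^ 'd) set" where
  "ring_sites \<sigma> k b = shell (\<sigma> ` {..k}) 1 (int k + 2) b"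

definition gadget_sites :: "(nat \<Rightarrow> 'd::finite) \<Rightarrow> nat \<Rightarrow> int ^ 'd \<Rightarrow> (int ^ 'd) set" where
  "gadget_sites \<sigma> k b = sphere_at (int k + 4) b \<union> ring_sites \<sigma> k b \<union> {tube_site \<sigma> k b}"

definition has_gadget :: "(nat \<Rightarrow> 'd::finite) \<Rightarrow> nat \<Rightarrow> (int ^ 'd) set \<Rightarrow> int ^ 'd \<Rightarrow> bool" where
  "has_gadget \<sigma> k F b \<longleftrightarrow> F \<inter> site_box (int k + 4) b = gadget_sites \<sigma> k b"

lemma gadget_sites_subset: "gadget_sites \<sigma> k b \<subseteq> site_box (int k + 4) b"
  by (auto simp: gadget_sites_def ring_sites_def tube_site_def shell_def site_box_def axis_nth)
    (smt (verit))

text \<open>The site of the hull that is adjacent to the tube site.\<close>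
definition exit_site :: "(nat \<Rightarrow> 'd::finite) \<Rightarrow> nat \<Rightarrow> int ^ 'd \<Rightarrow> int ^ 'd" where
  "exit_site \<sigma> k b = b + axis (\<sigma> 0) (int k + 4)"

lemma ring_connected_to_exit:
  assumes k: "0 < k" and \<sigma>: "inj_on \<sigma> {..k}" and F: "has_gadget \<sigma> k F b" and z: "z \<in> ring_sites \<sigma> k b"
  shows "(exit_site \<sigma> k b, z) \<in> (link F)\<^sup>*"
proof -
  let ?t = "\<lambda>m. b + axis (\<sigma> 0) (int k + m)"
  have t2: "?t 2 \<in> ring_sites \<sigma> k b"
    by (auto simp: ring_sites_def shell_def site_box_def axis_nth intro!: exI[of _ "\<sigma> 0"])
  have gF: "gadget_sites \<sigma> k b \<subseteq> F" using F by (auto simp: has_gadget_def)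
  have "?t 4 \<in> sphere_at (int k + 4) b"
    by (auto simp: shell_def site_box_def axis_nth intro!: exI[of _ "\<sigma> 0"])
  then have "?t 2 \<in> F" "?t 3 \<in> F" "?t 4 \<in> F"
    using t2 gF by (auto simp: gadget_sites_def tube_site_def)
  moreover have "adjacent (?t 4) (?t 3)" "adjacent (?t 3) (?t 2)"
    unfolding adjacent_def by (rule exI[of _ "\<sigma> 0"], simp add: vec_eq_iff axis_nth)+
  ultimately have "(?t 4, ?t 3) \<in> link F" "(?t 3, ?t 2) \<in> link F" by (auto simp: link_def)
  moreover have "(?t 2, z) \<in> (link (ring_sites \<sigma> k b))\<^sup>*"
    unfolding ring_sites_def
  proof (rule shell_connected)
    show "card (\<sigma> ` {..k}) \<ge> 2" using k by (simp add: card_image[OF \<sigma>])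
  qed (use t2 z in \<open>auto simp: ring_sites_def\<close>)
  then have "(?t 2, z) \<in> (link F)\<^sup>*"
    by (rule link_star_mono) (use gF in \<open>auto simp: gadget_sites_def\<close>)
  ultimately show ?thesis
    unfolding exit_site_def by (meson converse_rtrancl_into_rtrancl)
qed

text \<open>The cutoff vanishes up to the outer boundary of the ring, at distance \<open>k + 5/2\<close> from the centre of
  the cube of \<open>b\<close>, and is one from the inner boundary of the hull onwards; it interpolates across the
  tube cube. The detecting vector deforms the projection to the slab into a fixed unit vector
  accordingly, and normalising it gives a map to the sphere.\<close>
definition cutoff :: "nat \<Rightarrow> int ^ 'd::finite \<Rightarrow> real ^ 'd \<Rightarrow> real" where
  "cutoff k b x = min 1 (max 0 (infnorm (x - centre b) - (real k + 5/2)))"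

definition detect_vec :: "(nat \<Rightarrow> 'd::finite) \<Rightarrow> nat \<Rightarrow> int ^ 'd \<Rightarrow> real ^ 'd \<Rightarrow> nat \<Rightarrow> real" where
  "detect_vec \<sigma> k b x j = (1 - cutoff k b x) * (x - centre b) $ \<sigma> j + cutoff k b x * of_bool (j = 0)"

definition detect :: "(nat \<Rightarrow> 'd::finite) \<Rightarrow> nat \<Rightarrow> int ^ 'd \<Rightarrow> real ^ 'd \<Rightarrow> nat \<Rightarrow> real" where
  "detect \<sigma> k b x j =
     (if j \<le> k then detect_vec \<sigma> k b x j / sqrt (\<Sum>l\<le>k. (detect_vec \<sigma> k b x l)\<^sup>2) else 0)"

definition ring_sphere :: "(nat \<Rightarrow> 'd::finite) \<Rightarrow> nat \<Rightarrow> int ^ 'd \<Rightarrow> (nat \<Rightarrow> real) \<Rightarrow> real ^ 'd" where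
  "ring_sphere \<sigma> k b s = (\<chi> i. centre b $ i + (real k + 1) * (\<Sum>j\<le>k. if \<sigma> j = i then s j else 0))"

lemma cutoff_bounds: "0 \<le> cutoff k b x" "cutoff k b x \<le> 1"
  by (auto simp: cutoff_def)

lemma infnorm_le_cart:
  fixes x :: "real ^ 'd::finite"
  assumes "\<And>i. \<bar>x $ i\<bar> \<le> c"
  shows "infnorm x \<le> c"
  unfolding infnorm_cart using assms by (intro cSup_least) auto

lemma cutoff_eq_0: "(\<And>i. \<bar>x $ i - centre b $ i\<bar> \<le> real k + 5/2) \<Longrightarrow> cutoff k b x = 0"
  using infnorm_le_cart[of "x - centre b" "real k + 5/2"] by (simp add: cutoff_def)

lemma cutoff_eq_1: "\<bar>x $ i - centre b $ i\<bar> \<ge> real k + 7/2 \<Longrightarrow> cutoff k b x = 1"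
  using component_le_infnorm_cart[of "x - centre b" i] by (simp add: cutoff_def)

text \<open>In the region where the cutoff is less than one, the only cubes are those of the ring and the tube. On
  the ring the cutoff vanishes, and the projection is nonzero since the cube of \<open>b\<close> is missing. On
  the tube the coordinate \<open>\<sigma> 0\<close> of the projection is positive, so the segment from the projection
  to the fixed vector avoids the origin.\<close>
lemma detect_vec_nonzero:
  assumes F: "has_gadget \<sigma> k F b" and x: "x \<in> cubes_interior F"
  shows "(\<Sum>l\<le>k. (detect_vec \<sigma> k b x l)\<^sup>2) > 0"
proof -
  have "\<exists>j\<le>k. detect_vec \<sigma> k b x j \<noteq> 0"
  proof (cases "\<exists>i. \<bar>x $ i - centre b $ i\<bar> \<ge> real k + 7/2")
    case True
    then have "cutoff k b x = 1" using cutoff_eq_1 by blast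
    then show ?thesis by (auto simp: detect_vec_def)
  next
    case False
    then have x_near: "\<bar>x $ i - (of_int (b $ i) + 1/2)\<bar> < real k + 7/2" for i by (simp add: not_le)
    have "\<bar>\<lfloor>x $ i\<rfloor> - b $ i\<bar> \<le> int k + 3" for i using x_near[of i] by linarith
    then have box: "site x \<in> site_box (int k + 3) b" by (simp add: site_box_def)
    then have "site x \<in> site_box (int k + 4) b"
      unfolding site_box_def by (auto intro: order_trans)
    then have "site x \<in> gadget_sites \<sigma> k b"
      using site_of_cubes_interior[OF x] F by (auto simp: has_gadget_def)
    moreover have "site x \<notin> sphere_at (int k + 4) b" using box by (simp add: mem_sphere_at add.commute)
    ultimately consider "site x = tube_site \<sigma> k b" | "site x \<in> ring_sites \<sigma> k b"
      by (auto simp: gadget_sites_def)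
    then show ?thesis
    proof cases
      case 1
      then have "\<lfloor>x $ \<sigma> 0\<rfloor> = b $ \<sigma> 0 + int k + 3"
        by (simp add: vec_eq_iff tube_site_def axis_nth)
      then have pos: "(x - centre b) $ \<sigma> 0 > 0" by simp linarith
      let ?c = "cutoff k b x"
      have "detect_vec \<sigma> k b x 0 > 0"
      proof (cases "?c = 1")
        case False
        then have "(1 - ?c) * (x - centre b) $ \<sigma> 0 > 0"
          using pos cutoff_bounds(2)[of k b x] by (intro mult_pos_pos) auto
        then show ?thesis using cutoff_bounds(1)[of k b x] by (simp add: detect_vec_def)
      qed (simp add: detect_vec_def)
      then show ?thesis by (intro exI[of _ 0]) auto
    next
      case 2
      then have r: "\<bar>\<lfloor>x $ i\<rfloor> - b $ i\<bar> \<le> int k + 2" for i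
        by (auto simp: ring_sites_def shell_def site_box_def)
      have "\<bar>x $ i - centre b $ i\<bar> \<le> real k + 5/2" for i using r[of i] unfolding centre_nth by linarith
      then have c0: "cutoff k b x = 0" by (rule cutoff_eq_0)
      from 2 obtain j where j: "j \<le> k" "1 \<le> \<bar>\<lfloor>x $ \<sigma> j\<rfloor> - b $ \<sigma> j\<bar>"
        by (auto simp: ring_sites_def shell_def)
      have "x $ \<sigma> j - centre b $ \<sigma> j \<noteq> 0" using j(2) unfolding centre_nth by linarith
      then show ?thesis using j(1) c0 by (auto simp: detect_vec_def)
    qed
  qed
  then obtain j where j: "j \<le> k" "detect_vec \<sigma> k b x j \<noteq> 0" by blast
  then show ?thesis by (intro sum_pos2[of _ j]) auto
qed

lemma continuous_on_cutoff: "continuous_on S (cutoff k b)"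
  unfolding cutoff_def
  by (intro continuous_intros continuous_on_compose2[OF continuous_on_infnorm[of UNIV]]) auto

lemma continuous_map_detect:
  assumes F: "has_gadget \<sigma> k F b" and C: "C \<subseteq> cubes_interior F"
  shows "continuous_map (top_of_set C) (nsphere k) (detect \<sigma> k b)"
proof -
  have pos: "(\<Sum>l\<le>k. (detect_vec \<sigma> k b x l)\<^sup>2) > 0" if "x \<in> C" for x
    using detect_vec_nonzero[OF F] C that by blast
  have vec: "continuous_on C (\<lambda>x. detect_vec \<sigma> k b x j)" for j
    unfolding detect_vec_def by (intro continuous_intros continuous_on_cutoff)
  have "continuous_on C (\<lambda>x. detect \<sigma> k b x j)" for j
    unfolding detect_def using pos by (cases "j \<le> k") (force intro!: continuous_intros vec)+
  then have "continuous_on C (detect \<sigma> k b)"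
    by (rule continuous_on_coordinatewise_then_product)
  moreover have "(\<Sum>j\<le>k. (detect \<sigma> k b x j)\<^sup>2) = 1" if "x \<in> C" for x
  proof -
    have "(\<Sum>j\<le>k. (detect \<sigma> k b x j)\<^sup>2) = (\<Sum>j\<le>k. (detect_vec \<sigma> k b x j)\<^sup>2) / (\<Sum>l\<le>k. (detect_vec \<sigma> k b x l)\<^sup>2)"
      using pos[OF that] by (simp add: detect_def power_divide flip: sum_divide_distrib)
    then show ?thesis using pos[OF that] by simp
  qed
  ultimately show ?thesis
    unfolding nsphere_top_of_set by (auto simp: detect_def)
qed

lemma ring_sphere_nth:
  assumes "inj_on \<sigma> {..k}" "j \<le> k"
  shows "ring_sphere \<sigma> k b s $ \<sigma> j = centre b $ \<sigma> j + (real k + 1) * s j"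
proof -
  have "(\<Sum>l\<le>k. if \<sigma> l = \<sigma> j then s l else 0) = (\<Sum>l\<le>k. if l = j then s l else 0)"
    using assms by (intro sum.cong) (auto dest: inj_onD)
  also have "\<dots> = s j" using assms(2) by simp
  finally show ?thesis by (simp add: ring_sphere_def)
qed

lemma ring_sphere_nth_other:
  assumes "i \<notin> \<sigma> ` {..k}"
  shows "ring_sphere \<sigma> k b s $ i = centre b $ i"
proof -
  have "(\<Sum>j\<le>k. if \<sigma> j = i then s j else 0) = 0"
    using assms by (intro sum.neutral) auto
  then show ?thesis by (simp add: ring_sphere_def)
qed

lemma ring_sphere_dist:
  assumes \<sigma>: "inj_on \<sigma> {..k}" and s: "s \<in> topspace (nsphere k)"
  shows "\<bar>ring_sphere \<sigma> k b s $ i - centre b $ i\<bar> \<le> real k + 1"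
proof (cases "i \<in> \<sigma> ` {..k}")
  case True
  then obtain j where j: "j \<le> k" "i = \<sigma> j" by blast
  have "(s j)\<^sup>2 \<le> 1" by (rule topspace_nsphere_1[OF s])
  then have "\<bar>s j\<bar> \<le> 1" by (simp add: abs_square_le_1)
  then have "(real k + 1) * \<bar>s j\<bar> \<le> (real k + 1) * 1" by (intro mult_left_mono) auto
  then show ?thesis using ring_sphere_nth[OF \<sigma> j(1)] j(2) by (simp add: abs_mult del: centre_nth)
qed (simp add: ring_sphere_nth_other del: centre_nth)

lemma ring_sphere_in_ring:
  fixes \<sigma> :: "nat \<Rightarrow> 'd::finite"
  assumes \<sigma>: "inj_on \<sigma> {..k}" and s: "s \<in> topspace (nsphere k)"
  shows "ring_sphere \<sigma> k b s \<in> cubes_interior (ring_sites \<sigma> k b)"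
proof -
  let ?I = "\<sigma> ` {..k}"
  let ?c = "centre b"
  define U where "U = (\<Inter>i\<in>- ?I. {y :: real ^ 'd. \<bar>y $ i - ?c $ i\<bar> < 1/2}) \<inter>
    (\<Inter>i. {y. \<bar>y $ i - ?c $ i\<bar> < real k + 5/2}) \<inter> (\<Union>i\<in>?I. {y. \<bar>y $ i - ?c $ i\<bar> > 1/2})"
  have "open U"
    unfolding U_def
    by (intro open_Int open_INT open_UN ballI open_Collect_less continuous_intros) auto
  moreover have "U \<subseteq> (\<Union>z\<in>ring_sites \<sigma> k b. cube 1 z)"
  proof
    fix y assume y: "y \<in> U"
    have "\<lfloor>y $ i\<rfloor> = b $ i" if "i \<notin> ?I" for i
    proof -
      have "\<bar>y $ i - (of_int (b $ i) + 1/2)\<bar> < 1/2" using y that by (auto simp: U_def)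
      then show ?thesis by linarith
    qed
    moreover have "\<bar>\<lfloor>y $ i\<rfloor> - b $ i\<bar> \<le> int k + 2" for i
    proof -
      have "\<bar>y $ i - (of_int (b $ i) + 1/2)\<bar> < real k + 5/2" using y by (auto simp: U_def)
      then show ?thesis by linarith
    qed
    moreover have "\<exists>i\<in>?I. 1 \<le> \<bar>\<lfloor>y $ i\<rfloor> - b $ i\<bar>"
    proof -
      obtain i where "i \<in> ?I" "\<bar>y $ i - (of_int (b $ i) + 1/2)\<bar> > 1/2" using y by (auto simp: U_def)
      then show ?thesis by (intro bexI[of _ i]) linarith+
    qed
    ultimately have "site y \<in> ring_sites \<sigma> k b" by (simp add: ring_sites_def shell_def site_box_def)
    then show "y \<in> (\<Union>z\<in>ring_sites \<sigma> k b. cube 1 z)" using mem_cube_site by blast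
  qed
  ultimately have "U \<subseteq> cubes_interior (ring_sites \<sigma> k b)"
    unfolding cubes_interior_def by (intro interior_maximal)
  moreover have "ring_sphere \<sigma> k b s \<in> U"
  proof -
    let ?y = "ring_sphere \<sigma> k b s"
    \<comment> \<open>The squares of the \<open>k + 1\<close> coordinates of \<open>s\<close> add up to one, so one of them is large enough for
      the point to lie outside the cube of \<open>b\<close>.\<close>
    have "\<exists>j\<le>k. (real k + 1) * \<bar>s j\<bar> > 1/2"
    proof (rule ccontr)
      assume "\<not> ?thesis"
      then have "(real k + 1) * \<bar>s j\<bar> \<le> 1/2" if "j \<le> k" for j using that by (auto simp: not_less)
      then have "((real k + 1) * \<bar>s j\<bar>)\<^sup>2 \<le> (1/2)\<^sup>2" if "j \<le> k" for j
        using that by (intro power_mono) auto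
      then have "(\<Sum>j\<le>k. ((real k + 1) * \<bar>s j\<bar>)\<^sup>2) \<le> (\<Sum>j\<le>k. (1/2)\<^sup>2)"
        by (intro sum_mono) auto
      moreover have "(\<Sum>j\<le>k. ((real k + 1) * \<bar>s j\<bar>)\<^sup>2) = (real k + 1)\<^sup>2"
        using s unfolding nsphere_top_of_set
        by (simp add: power_mult_distrib flip: sum_distrib_left)
      moreover have "(\<Sum>j\<le>k. (1/2)\<^sup>2) = (real k + 1) * (1/4)" by (simp add: power2_eq_square)
      ultimately have "(real k + 1)\<^sup>2 \<le> (real k + 1) * (1/4)" by linarith
      moreover have "(real k + 1) * 1 \<le> (real k + 1)\<^sup>2"
        unfolding power2_eq_square by (intro mult_left_mono) auto
      ultimately have "(real k + 1) * 1 \<le> (real k + 1) * (1/4)" by (rule order_trans[rotated])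
      then show False by simp
    qed
    then obtain j where j: "j \<le> k" "(real k + 1) * \<bar>s j\<bar> > 1/2" by blast
    have "\<bar>?y $ \<sigma> j - ?c $ \<sigma> j\<bar> > 1/2"
      using ring_sphere_nth[OF \<sigma> j(1), of b s] j(2) by (simp add: abs_mult del: centre_nth)
    moreover have "\<bar>?y $ i - ?c $ i\<bar> < real k + 5/2" for i
      using ring_sphere_dist[OF \<sigma> s, of b i] by linarith
    moreover have "?y $ i = ?c $ i" if "i \<notin> ?I" for i using ring_sphere_nth_other[OF that] .
    ultimately show ?thesis unfolding U_def using j(1) by (auto simp del: centre_nth)
  qed
  ultimately show ?thesis by blast
qed

lemma continuous_map_ring_sphere:
  assumes \<sigma>: "inj_on \<sigma> {..k}" and K: "ring_sites \<sigma> k b \<subseteq> K"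
  shows "continuous_map (nsphere k) (top_of_set (cubes_interior K)) (ring_sphere \<sigma> k b)"
proof -
  have "continuous_on S (\<lambda>s::nat \<Rightarrow> real. if \<sigma> j = i then s j else 0)" for S i j
    using continuous_on_subset[OF continuous_on_product_coordinates, of S j]
    by (cases "\<sigma> j = i") (auto intro!: continuous_intros)
  then have "continuous_on S (ring_sphere \<sigma> k b)" for S
    unfolding ring_sphere_def by (intro continuous_intros)
  moreover have "ring_sphere \<sigma> k b s \<in> cubes_interior K" if "s \<in> topspace (nsphere k)" for s
    using ring_sphere_in_ring[OF \<sigma> that] cubes_interior_mono[OF K] by blast
  ultimately show ?thesis
    unfolding nsphere_top_of_set by auto
qed

lemma detect_ring_sphere:
  assumes \<sigma>: "inj_on \<sigma> {..k}" and s: "s \<in> topspace (nsphere k)"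
  shows "detect \<sigma> k b (ring_sphere \<sigma> k b s) = s"
proof -
  let ?y = "ring_sphere \<sigma> k b s"
  have "cutoff k b ?y = 0"
  proof (rule cutoff_eq_0)
    fix i show "\<bar>?y $ i - centre b $ i\<bar> \<le> real k + 5/2"
      using ring_sphere_dist[OF \<sigma> s, of b i] by linarith
  qed
  then have v: "detect_vec \<sigma> k b ?y j = (real k + 1) * s j" if "j \<le> k" for j
    using ring_sphere_nth[OF \<sigma> that] by (simp add: detect_vec_def del: centre_nth)
  have "(\<Sum>l\<le>k. (detect_vec \<sigma> k b ?y l)\<^sup>2) = (\<Sum>l\<le>k. (real k + 1)\<^sup>2 * (s l)\<^sup>2)"
    by (intro sum.cong) (auto simp: v power_mult_distrib)
  also have "\<dots> = (real k + 1)\<^sup>2" using s unfolding nsphere_top_of_set by (simp flip: sum_distrib_left)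
  finally have "sqrt (\<Sum>l\<le>k. (detect_vec \<sigma> k b ?y l)\<^sup>2) = real k + 1" by simp
  then show ?thesis
    using s v unfolding nsphere_top_of_set by (intro ext) (auto simp: detect_def)
qed

text \<open>A ring at a distant gadget lies where the cutoff is one, so it is mapped to a single point.\<close>
lemma detect_other_ring_sphere:
  assumes \<sigma>: "inj_on \<sigma> {..k}" and s: "s \<in> topspace (nsphere k)"
    and far: "\<bar>b $ i - b' $ i\<bar> \<ge> 2 * int k + 7"
  shows "detect \<sigma> k b (ring_sphere \<sigma> k b' s) = (\<lambda>j. if j = 0 then 1 else 0)"
proof -
  let ?y = "ring_sphere \<sigma> k b' s"
  have "cutoff k b ?y = 1"
  proof (rule cutoff_eq_1)
    show "\<bar>?y $ i - centre b $ i\<bar> \<ge> real k + 7/2"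
      using ring_sphere_dist[OF \<sigma> s, of b' i] far unfolding centre_nth by linarith
  qed
  then have v: "detect_vec \<sigma> k b ?y j = of_bool (j = 0)" for j by (simp add: detect_vec_def)
  have "(\<Sum>l\<le>k. (of_bool (l = 0) :: real)\<^sup>2) = (\<Sum>l\<le>k. if l = 0 then 1 else 0)"
    by (intro sum.cong) auto
  then have "(\<Sum>l\<le>k. (of_bool (l = 0) :: real)\<^sup>2) = 1" by simp
  then show ?thesis by (intro ext) (auto simp: detect_def v)
qed

lemma card_gadgets_le_betti:
  assumes k: "0 < k" and \<sigma>: "inj_on \<sigma> {..k}" and B: "finite B" and K: "K \<subseteq> F"
    and gadget: "\<And>b. b \<in> B \<Longrightarrow> has_gadget \<sigma> k F b" "\<And>b. b \<in> B \<Longrightarrow> ring_sites \<sigma> k b \<subseteq> K"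
    and far: "\<And>b b'. b \<in> B \<Longrightarrow> b' \<in> B \<Longrightarrow> b \<noteq> b' \<Longrightarrow> \<exists>i. \<bar>b $ i - b' $ i\<bar> \<ge> 2 * int k + 7"
  shows "enat (card B) \<le> betti k (cubes_interior K)"
proof (rule card_le_betti[OF k B, where f = "detect \<sigma> k" and g = "ring_sphere \<sigma> k"])
  show "detect \<sigma> k b (ring_sphere \<sigma> k b' s) = (\<lambda>j. if j = 0 then 1 else 0)"
    if "b \<in> B" "b' \<in> B" "b \<noteq> b'" "s \<in> topspace (nsphere k)" for b b' s
    using far[OF that(1-3)] detect_other_ring_sphere[OF \<sigma> that(4)] by blast
  show "(\<lambda>j. if j = 0 then 1 else 0) \<in> topspace (nsphere k)" by (rule in_topspace_nsphere)
  show "continuous_map (top_of_set (cubes_interior K)) (nsphere k) (detect \<sigma> k b)" if "b \<in> B" for b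
    using gadget(1)[OF that] cubes_interior_mono[OF K] by (rule continuous_map_detect)
qed (use \<sigma> gadget in \<open>auto intro: continuous_map_ring_sphere detect_ring_sphere\<close>)

section \<open>Independent colours and finite modifications\<close>

abbreviation iid :: "'a pmf \<Rightarrow> ('i \<Rightarrow> 'a) measure" where
  "iid D \<equiv> PiM UNIV (\<lambda>_. measure_pmf D)"

lemma prob_space_iid: "prob_space (iid D)"
  by (intro prob_space_PiM measure_pmf.prob_space_axioms)

lemma space_iid [simp]: "space (iid D) = UNIV"
  by (simp add: space_PiM PiE_UNIV_domain)

lemma indep_vars_iid:
  fixes D :: "'a pmf"
  shows "prob_space.indep_vars (iid D) (\<lambda>_. measure_pmf D) (\<lambda>(i :: 'i) \<omega>. \<omega> i) UNIV"
proof -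
  interpret prob_space "iid D :: ('i \<Rightarrow> 'a) measure" by (rule prob_space_iid)
  have "distr (iid D) (measure_pmf D) (\<lambda>\<omega>. \<omega> i) = measure_pmf D" for i :: 'i
    by (intro distr_PiM_component measure_pmf.prob_space_axioms) auto
  then show ?thesis
    by (subst indep_vars_iff_distr_eq_PiM) (auto simp: restrict_def distr_id2)
qed

lemma distr_iid_map:
  fixes D :: "'a pmf" and h :: "'a \<Rightarrow> 'b" and E :: "'b pmf"
  shows "distr (iid D) (iid E) (\<lambda>\<omega> (i :: 'i). h (\<omega> i)) = iid (map_pmf h D)"
proof -
  interpret prob_space "iid D :: ('i \<Rightarrow> 'a) measure" by (rule prob_space_iid)
  have h: "h \<in> measurable (measure_pmf D) (measure_pmf E)" by simp
  have X: "random_variable (measure_pmf E) (\<lambda>\<omega>. h (\<omega> i))" for i :: 'i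
    using measurable_compose[of "\<lambda>\<omega>. \<omega> i" "iid D" "measure_pmf D" h, OF measurable_component_singleton h]
    by simp
  have "indep_vars (\<lambda>_. measure_pmf E) (\<lambda>(i :: 'i) \<omega>. h (\<omega> i)) UNIV"
    by (rule indep_vars_compose2[OF indep_vars_iid]) simp
  then have "distr (iid D) (iid E) (\<lambda>\<omega>. \<lambda>i\<in>(UNIV :: 'i set). h (\<omega> i)) =
      PiM UNIV (\<lambda>i. distr (iid D) (measure_pmf E) (\<lambda>\<omega>. h (\<omega> i)))"
    using indep_vars_iff_distr_eq_PiM[where I = UNIV and M' = "\<lambda>_. measure_pmf E" and X = "\<lambda>i \<omega>. h (\<omega> i)", OF _ X] by simp
  also have "\<dots> = iid (map_pmf h D)"
  proof (rule PiM_cong)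
    fix i :: 'i
    have "distr (iid D) (measure_pmf E) (\<lambda>\<omega>. h (\<omega> i)) =
      distr (distr (iid D) (measure_pmf D) (\<lambda>\<omega>. \<omega> i)) (measure_pmf E) h"
      by (subst distr_distr) (auto simp: comp_def)
    also have "\<dots> = distr (measure_pmf D) (measure_pmf E) h"
      by (subst distr_PiM_component) (auto intro: measure_pmf.prob_space_axioms)
    also have "\<dots> = distr (measure_pmf D) (count_space UNIV) h"
      by (rule distr_cong) auto
    finally show "distr (iid D) (measure_pmf E) (\<lambda>\<omega>. h (\<omega> i)) = measure_pmf (map_pmf h D)"
      by (simp add: map_pmf_rep_eq)
  qed simp
  finally show ?thesis by (simp add: restrict_def)
qed

abbreviation (input) blacks :: "(int ^ 'd::finite \<Rightarrow> bool) \<Rightarrow> (int ^ 'd) set" where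
  "blacks \<omega> \<equiv> {z. \<omega> z}"

lemma percolation_iid: "percolation p = iid (bernoulli_pmf p)"
  by (simp add: percolation_def)

lemma prob_space_percolation: "prob_space (percolation p)"
  unfolding percolation_iid by (rule prob_space_iid)

lemma space_percolation [simp]: "space (percolation p) = UNIV"
  by (simp add: percolation_iid)

lemma pred_site [measurable]: "Measurable.pred (percolation p) (\<lambda>\<omega>. \<omega> z)"
  using measurable_component_singleton[of z UNIV "\<lambda>_. measure_pmf (bernoulli_pmf p)"]
  by (simp add: percolation_iid)

lemma pred_link [measurable]: "Measurable.pred (percolation p) (\<lambda>\<omega>. (x, y) \<in> (link (blacks \<omega>))\<^sup>*)"
proof -
  have "Measurable.pred (percolation p) (\<lambda>\<omega>. (x, y) \<in> link (blacks \<omega>) ^^ n)" for n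
  proof (induction n arbitrary: y)
    case (Suc n)
    have "(x, y) \<in> link (blacks \<omega>) ^^ Suc n \<longleftrightarrow>
      (\<exists>z. (x, z) \<in> link (blacks \<omega>) ^^ n \<and> \<omega> z \<and> \<omega> y \<and> adjacent z y)" for \<omega>
      by (auto simp: link_def)
    then show ?case using Suc by simp
  qed simp
  then show ?thesis by (simp add: rtrancl_power)
qed

lemma pred_finite_dependence:
  fixes P :: "(int ^ 'd::finite \<Rightarrow> bool) \<Rightarrow> bool"
  assumes S: "finite S" and P: "\<And>\<omega> \<omega>'. (\<And>z. z \<in> S \<Longrightarrow> \<omega> z = \<omega>' z) \<Longrightarrow> P \<omega> = P \<omega>'"
  shows "Measurable.pred (percolation p) P"
proof -
  have eq: "P \<omega> \<longleftrightarrow> (\<exists>T\<in>{T \<in> Pow S. P (\<lambda>z. z \<in> T)}. \<forall>z\<in>S. \<omega> z = (z \<in> T))" for \<omega>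
  proof
    assume "P \<omega>"
    moreover have "P (\<lambda>z. z \<in> {z \<in> S. \<omega> z}) = P \<omega>" by (rule P) auto
    ultimately show "\<exists>T\<in>{T \<in> Pow S. P (\<lambda>z. z \<in> T)}. \<forall>z\<in>S. \<omega> z = (z \<in> T)"
      by (intro bexI[of _ "{z \<in> S. \<omega> z}"]) auto
  next
    assume "\<exists>T\<in>{T \<in> Pow S. P (\<lambda>z. z \<in> T)}. \<forall>z\<in>S. \<omega> z = (z \<in> T)"
    then obtain T where "P (\<lambda>z. z \<in> T)" "\<forall>z\<in>S. \<omega> z = (z \<in> T)" by blast
    then show "P \<omega>" using P[of \<omega> "\<lambda>z. z \<in> T"] by simp
  qed
  have "Measurable.pred (percolation p)
      (\<lambda>\<omega>. \<exists>T\<in>{T \<in> Pow S. P (\<lambda>z. z \<in> T)}. \<forall>z\<in>S. \<omega> z = (z \<in> T))"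
  proof (rule pred_intros_finite(4))
    show "Measurable.pred (percolation p) (\<lambda>\<omega>. \<forall>z\<in>S. \<omega> z = (z \<in> T))" for T
      using S by (intro pred_intros_finite(3)) measurable
  qed (use S in simp)
  then show ?thesis by (rule ssubst[where P = "Measurable.pred (percolation p)", OF ext[OF eq]])
qed

definition agrees :: "'a set \<Rightarrow> ('a \<Rightarrow> bool) \<Rightarrow> ('a \<Rightarrow> bool) \<Rightarrow> bool" where
  "agrees S \<eta> \<omega> \<longleftrightarrow> (\<forall>z\<in>S. \<omega> z = \<eta> z)"

lemma pred_agrees: "finite S \<Longrightarrow> Measurable.pred (percolation p) (agrees S \<eta>)"
  by (rule pred_finite_dependence[of S]) (auto simp: agrees_def)

lemma prob_agrees_ge:
  fixes S :: "(int ^ 'd::finite) set"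
  assumes S: "finite S" and p: "0 \<le> p" "p \<le> 1"
  shows "measure (percolation p) {\<omega>. agrees S \<eta> \<omega>} \<ge> min p (1 - p) ^ card S"
proof -
  let ?D = "\<lambda>_ :: int ^ 'd. measure_pmf (bernoulli_pmf p)"
  interpret product_prob_space ?D UNIV by unfold_locales
  have "emeasure (percolation p) {\<omega>. agrees S \<eta> \<omega>} = (\<Prod>z\<in>S. emeasure (?D z) {\<eta> z})"
    using emeasure_PiM_Collect[of S "\<lambda>z. {\<eta> z}"] S
    by (simp add: percolation_def agrees_def space_PiM)
  also have "\<dots> = ennreal (\<Prod>z\<in>S. pmf (bernoulli_pmf p) (\<eta> z))"
    by (simp add: emeasure_pmf_single prod_ennreal)
  finally have "measure (percolation p) {\<omega>. agrees S \<eta> \<omega>} = (\<Prod>z\<in>S. pmf (bernoulli_pmf p) (\<eta> z))"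
    by (simp add: measure_def prod_nonneg)
  moreover have "(\<Prod>z\<in>S. min p (1 - p)) \<le> (\<Prod>z\<in>S. pmf (bernoulli_pmf p) (\<eta> z))"
  proof (rule prod_mono)
    fix z show "0 \<le> min p (1 - p) \<and> min p (1 - p) \<le> pmf (bernoulli_pmf p) (\<eta> z)"
      using p by (cases "\<eta> z") auto
  qed
  ultimately show ?thesis by simp
qed

text \<open>What remains of an event after the colours on a finite set are overwritten depends only on the other
  sites, so it is independent of the original colours on that set. This is the finite modification
  argument: a pattern can be imposed at the price of its own probability.\<close>
lemma prob_agrees_indep:
  fixes S :: "(int ^ 'd::finite) set"
  assumes S: "finite S" and A: "A \<in> sets (percolation p)"
  shows "measure (percolation p) {\<omega>. agrees S \<eta> \<omega> \<and> override_on \<omega> \<eta> S \<in> A} =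
    measure (percolation p) {\<omega>. agrees S \<eta> \<omega>} * measure (percolation p) {\<omega>. override_on \<omega> \<eta> S \<in> A}"
proof -
  let ?D = "\<lambda>_ :: int ^ 'd. measure_pmf (bernoulli_pmf p)"
  interpret P: prob_space "iid (bernoulli_pmf p) :: (int ^ 'd \<Rightarrow> bool) measure" by (rule prob_space_iid)
  let ?X = "\<lambda>\<omega>. restrict (\<lambda>z. \<omega> z :: bool) S" and ?Y = "\<lambda>\<omega>. restrict (\<lambda>z. \<omega> z :: bool) (- S)"
  have ind: "P.indep_var (PiM S ?D) ?X (PiM (- S) ?D) ?Y"
    by (rule P.indep_var_restrict[OF indep_vars_iid]) auto
  have E1: "{\<eta>' \<in> space (PiM S ?D). \<forall>z\<in>S. \<eta>' z = \<eta> z} \<in> sets (PiM S ?D)"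
  proof -
    have "{\<eta>' \<in> space (PiM S ?D). \<forall>z\<in>S. \<eta>' z = \<eta> z} = Pi\<^sub>E S (\<lambda>z. {\<eta> z})"
      by (simp only: set_eq_iff space_PiM PiE_iff mem_Collect_eq space_measure_pmf UNIV_I singleton_iff) blast
    then show ?thesis using S by (auto intro: sets_PiM_I_finite)
  qed
  have ov: "(\<lambda>\<zeta> z. if z \<in> S then \<eta> z else \<zeta> z) \<in> measurable (PiM (- S) ?D) (percolation p)"
    unfolding percolation_def
  proof (rule measurable_PiM_single')
    fix z :: "int ^ 'd"
    show "(\<lambda>\<zeta>. if z \<in> S then \<eta> z else \<zeta> z) \<in> measurable (PiM (- S) ?D) (?D z)"
      using measurable_component_singleton[of z "- S" ?D] by (cases "z \<in> S") simp_all
  qed auto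
  have E2: "{\<zeta> \<in> space (PiM (- S) ?D). (\<lambda>z. if z \<in> S then \<eta> z else \<zeta> z) \<in> A} \<in> sets (PiM (- S) ?D)"
    using measurable_sets[OF ov A] by (simp add: vimage_def Int_def conj_commute)
  have eq: "(\<lambda>z. if z \<in> S then \<eta> z else restrict \<omega> (- S) z) = override_on \<omega> \<eta> S" for \<omega>
    by (auto simp: override_on_def)
  have 1: "?X \<omega> \<in> space (PiM S ?D)" "?Y \<omega> \<in> space (PiM (- S) ?D)" for \<omega> by (auto simp: space_PiM)
  have "P.prob ((\<lambda>\<omega>. (?X \<omega>, ?Y \<omega>)) -` ({\<eta>' \<in> space (PiM S ?D). \<forall>z\<in>S. \<eta>' z = \<eta> z} \<times>
      {\<zeta> \<in> space (PiM (- S) ?D). (\<lambda>z. if z \<in> S then \<eta> z else \<zeta> z) \<in> A}) \<inter> space (iid (bernoulli_pmf p))) =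
    P.prob (?X -` {\<eta>' \<in> space (PiM S ?D). \<forall>z\<in>S. \<eta>' z = \<eta> z} \<inter> space (iid (bernoulli_pmf p))) *
    P.prob (?Y -` {\<zeta> \<in> space (PiM (- S) ?D). (\<lambda>z. if z \<in> S then \<eta> z else \<zeta> z) \<in> A} \<inter> space (iid (bernoulli_pmf p)))"
    by (rule P.indep_varD[OF ind E1 E2])
  then show ?thesis
    using 1 by (simp add: vimage_def agrees_def eq flip: percolation_iid)
qed

lemma measurable_override_on:
  "(\<lambda>\<omega>. override_on \<omega> \<eta> S) \<in> measurable (percolation p) (percolation p)"
  unfolding percolation_def
proof (rule measurable_PiM_single')
  fix z
  show "(\<lambda>\<omega>. override_on \<omega> \<eta> S z) \<in> measurable (iid (bernoulli_pmf p)) (measure_pmf (bernoulli_pmf p))"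
    by (cases "z \<in> S") (simp_all add: pred_site[unfolded percolation_iid])
qed auto

lemma sets_card_ge:
  assumes "finite I" and A: "\<And>i. i \<in> I \<Longrightarrow> A i \<in> sets M"
  shows "{\<omega> \<in> space M. m \<le> real (card {i \<in> I. \<omega> \<in> A i})} \<in> sets M"
proof -
  let ?N = "\<lambda>\<omega>. \<Sum>i\<in>I. indicator (A i) \<omega> :: real"
  have N: "?N \<omega> = real (card {i \<in> I. \<omega> \<in> A i})" for \<omega>
    using assms(1) by (simp add: indicator_def sum.If_cases Int_def)
  have "?N \<in> borel_measurable M" using A by measurable
  then have "{\<omega> \<in> space M. m \<le> ?N \<omega>} \<in> sets M" by measurable
  then show ?thesis by (simp add: N)
qed

text \<open>The number of events that occur has mean at least \<open>q * card I\<close> and never exceeds \<open>card I\<close>; if it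
  reached \<open>q / 2 * card I\<close> with a probability below \<open>q / 2\<close>, its mean would be below
  \<open>q * card I\<close>.\<close>
lemma (in prob_space) prob_many_events_ge:
  assumes I: "finite I" and A: "\<And>i. i \<in> I \<Longrightarrow> A i \<in> events" and q: "\<And>i. i \<in> I \<Longrightarrow> prob (A i) \<ge> q"
    and I0: "I \<noteq> {}" and q0: "0 \<le> q"
  shows "prob {\<omega> \<in> space M. real (card {i \<in> I. \<omega> \<in> A i}) \<ge> q / 2 * card I} \<ge> q / 2"
proof -
  let ?N = "\<lambda>\<omega>. \<Sum>i\<in>I. indicator (A i) \<omega> :: real"
  have N: "?N \<omega> = real (card {i \<in> I. \<omega> \<in> A i})" for \<omega>
    using I by (simp add: indicator_def sum.If_cases Int_def)
  define E where "E = {\<omega> \<in> space M. real (card {i \<in> I. \<omega> \<in> A i}) \<ge> q / 2 * card I}"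
  have E: "E \<in> events" unfolding E_def using I A by (rule sets_card_ge)
  have c: "real (card I) > 0" using I I0 by (simp add: card_gt_0_iff)
  let ?c = "real (card I)"
  have "q * ?c \<le> (\<Sum>i\<in>I. prob (A i))"
    using sum_mono[of I "\<lambda>_. q" "\<lambda>i. prob (A i)"] q by (simp add: mult.commute)
  also have "\<dots> = expectation ?N"
    using A by (subst Bochner_Integration.integral_sum) (auto simp: emeasure_eq_measure)
  also have "\<dots> \<le> expectation (\<lambda>\<omega>. q / 2 * ?c + ?c * indicator E \<omega>)"
  proof (rule integral_mono)
    show "integrable M ?N" using A by (auto simp: emeasure_eq_measure)
    show "integrable M (\<lambda>\<omega>. q / 2 * ?c + ?c * indicator E \<omega>)"
      using E by (auto simp: emeasure_eq_measure)
    fix \<omega> assume \<omega>: "\<omega> \<in> space M"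
    have "real (card {i \<in> I. \<omega> \<in> A i}) \<le> ?c" using I by (auto intro: card_mono)
    moreover have "0 \<le> q / 2 * ?c" using q0 by simp
    moreover have "real (card {i \<in> I. \<omega> \<in> A i}) < q / 2 * ?c" if "\<omega> \<notin> E"
      using that \<omega> by (simp add: E_def)
    ultimately show "?N \<omega> \<le> q / 2 * ?c + ?c * indicator E \<omega>"
      unfolding N by (cases "\<omega> \<in> E") auto
  qed
  also have "\<dots> = q / 2 * ?c + ?c * prob E"
    using E by (subst Bochner_Integration.integral_add) (auto simp: emeasure_eq_measure prob_space)
  finally have "?c * (q / 2) \<le> ?c * prob E" by (simp add: algebra_simps)
  then have "q / 2 \<le> prob E" using c by simp
  then show ?thesis by (simp only: E_def)
qed

section \<open>Long paths above the critical probability\<close>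

lemma link_star_translate:
  assumes "(x, y) \<in> (link {z. \<omega> (z + b)})\<^sup>*"
  shows "(x + b, y + b) \<in> (link (blacks \<omega>))\<^sup>*"
  using assms
proof (induction rule: rtrancl_induct)
  case (step y z)
  have "adjacent (y + b) (z + b)"
    using step.hyps(2) by (auto simp: link_def adjacent_def algebra_simps)
  then have "(y + b, z + b) \<in> link (blacks \<omega>)" using step.hyps(2) by (auto simp: link_def)
  then show ?case using step.IH by (rule rtrancl_into_rtrancl[rotated])
qed simp

definition arm :: "int \<Rightarrow> int ^ 'd::finite \<Rightarrow> (int ^ 'd) set \<Rightarrow> bool" where
  "arm R b F \<longleftrightarrow> (\<exists>y. y \<notin> site_box R b \<and> (b, y) \<in> (link F)\<^sup>*)"

lemma arm_mono: "arm R b F \<Longrightarrow> F \<subseteq> G \<Longrightarrow> arm R b G"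
  unfolding arm_def using link_star_mono by blast

lemma pred_arm [measurable]: "Measurable.pred (percolation p) (\<lambda>\<omega>. arm R b (blacks \<omega>))"
  unfolding arm_def by measurable

text \<open>Colour a site black if it is black in at least one of two independent colourings, of densities \<open>q\<close>
  and \<open>r\<close>, where \<open>(1 - q) * (1 - r) = 1 - p\<close>. The result has density \<open>p\<close> and contains
  the first colouring.\<close>
lemma measure_percolation_mono:
  fixes A :: "(int ^ 'd::finite \<Rightarrow> bool) set"
  assumes q: "0 \<le> q" "q \<le> p" "p \<le> 1" and A: "A \<in> sets (percolation p)"
    and up: "\<And>\<omega> \<omega>'. \<omega> \<in> A \<Longrightarrow> blacks \<omega> \<subseteq> blacks \<omega>' \<Longrightarrow> \<omega>' \<in> A"
  shows "measure (percolation q) A \<le> measure (percolation p) A"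
proof (cases "q = 1")
  case False
  then have q1: "q < 1" using q by simp
  define r where "r = (p - q) / (1 - q)"
  have r: "0 \<le> r" "r \<le> 1" "(1 - q) * (1 - r) = 1 - p" using q q1 by (auto simp: r_def field_simps)
  define D where "D = pair_pmf (bernoulli_pmf q) (bernoulli_pmf r)"
  let ?h = "\<lambda>(a, b). a \<or> b"
  have Dq: "map_pmf fst D = bernoulli_pmf q" by (simp add: D_def map_fst_pair_pmf)
  have Dp: "map_pmf ?h D = bernoulli_pmf p"
  proof (rule pmf_eqI)
    have "?h -` {False} = {(False, False)}" by auto
    then have F: "pmf (map_pmf ?h D) False = 1 - p"
      using r q q1 by (simp add: pmf_map D_def measure_pmf_single pmf_pair)
    have "pmf (map_pmf ?h D) True + pmf (map_pmf ?h D) False = 1"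
      using sum_pmf_eq_1[OF finite_class.finite_UNIV subset_UNIV, of "map_pmf ?h D"] by (simp add: UNIV_bool add.commute)
    then show "pmf (map_pmf ?h D) b = pmf (bernoulli_pmf p) b" for b
      using F q by (cases b) auto
  qed
  interpret N: prob_space "iid D :: (int ^ 'd \<Rightarrow> bool \<times> bool) measure" by (rule prob_space_iid)
  have dist: "measure (percolation s) A = N.prob {\<omega>. (\<lambda>z. h (\<omega> z)) \<in> A} \<and> {\<omega>. (\<lambda>z. h (\<omega> z)) \<in> A} \<in> N.events"
    if h: "map_pmf h D = bernoulli_pmf s" for h s
  proof -
    have 1: "percolation s = distr (iid D) (percolation p) (\<lambda>\<omega> (z :: int ^ 'd). h (\<omega> z))"
      unfolding percolation_iid distr_iid_map h ..
    have 2: "(\<lambda>\<omega> z. h (\<omega> z)) \<in> measurable (iid D) (percolation p :: (int ^ 'd \<Rightarrow> bool) measure)"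
      unfolding percolation_def
    proof (rule measurable_PiM_single')
      fix z :: "int ^ 'd"
      show "(\<lambda>\<omega>. h (\<omega> z)) \<in> measurable (iid D) (measure_pmf (bernoulli_pmf p))"
        using measurable_compose[of "\<lambda>\<omega>. \<omega> z" "iid D" "measure_pmf D" h "measure_pmf (bernoulli_pmf p)"]
          measurable_component_singleton[of z UNIV "\<lambda>_. measure_pmf D"] by simp
    qed auto
    show ?thesis
      unfolding 1 using measure_distr[OF 2 A] measurable_sets[OF 2 A] by (simp add: vimage_def)
  qed
  have "{\<omega>. (\<lambda>z. fst (\<omega> z)) \<in> A} \<subseteq> {\<omega>. (\<lambda>z. ?h (\<omega> z)) \<in> A}"
    by (auto intro: up split: prod.splits simp: case_prod_unfold)
  then have "N.prob {\<omega>. (\<lambda>z. fst (\<omega> z)) \<in> A} \<le> N.prob {\<omega>. (\<lambda>z. ?h (\<omega> z)) \<in> A}"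
    using dist[OF Dp] by (intro N.finite_measure_mono) auto
  then show ?thesis using dist[OF Dp] dist[OF Dq] by simp
qed (use q in auto)

lemma measure_percolation_translate:
  fixes A :: "(int ^ 'd::finite \<Rightarrow> bool) set"
  assumes A: "A \<in> sets (percolation p)"
  shows "measure (percolation p) {\<omega>. (\<lambda>z. \<omega> (z + b)) \<in> A} = measure (percolation p) A"
    "{\<omega>. (\<lambda>z. \<omega> (z + b)) \<in> A} \<in> sets (percolation p)"
proof -
  let ?t = "\<lambda>\<omega> z. \<omega> (z + b) :: bool"
  have t: "?t \<in> measurable (percolation p) (percolation p)"
    unfolding percolation_def
    by (rule measurable_PiM_single') (auto intro: pred_site[unfolded percolation_def])
  have "distr (percolation p) (percolation p) ?t = percolation p"
    using distr_PiM_reindex[of UNIV "\<lambda>_. measure_pmf (bernoulli_pmf p)" "\<lambda>z. z + b" UNIV]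
    by (simp add: percolation_def restrict_def inj_on_def measure_pmf.prob_space_axioms)
  then show "measure (percolation p) {\<omega>. ?t \<omega> \<in> A} = measure (percolation p) A"
    using measure_distr[OF t A] by (simp add: vimage_def)
  show "{\<omega>. ?t \<omega> \<in> A} \<in> sets (percolation p)"
    using measurable_sets[OF t A] by (simp add: vimage_def)
qed

lemma cubes_in_origin_component:
  "cubes_in (origin_component \<omega>) = (if \<omega> 0 then cluster (blacks \<omega>) 0 else {})"
proof -
  let ?F = "blacks \<omega>"
  have *: "\<omega> 0 \<and> C = cubes_interior (cluster ?F 0)"
    if C: "C \<in> components (cubes_interior ?F)" "interior (cube 1 0) \<subseteq> C" for C
  proof
    have c: "centre 0 \<in> C" using C(2) centre_in_interior_cube by blast
    then show 0: "\<omega> 0" using in_components_subset[OF C(1)] centre_in_cubes_interior[of 0 ?F] by blast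
    have "C = connected_component_set (cubes_interior ?F) (centre 0)"
    proof -
      obtain x where "C = connected_component_set (cubes_interior ?F) x" using C(1) by (auto simp: components_def)
      then show ?thesis using c connected_component_eq by metis
    qed
    then show "C = cubes_interior (cluster ?F 0)" using component_eq_cluster[of 0 ?F] 0 by simp
  qed
  show ?thesis
  proof (cases "\<omega> 0")
    case True
    have "cubes_interior (cluster ?F 0) \<in> components (cubes_interior ?F)"
      using True by (simp add: components_cubes_interior)
    moreover have "interior (cube 1 0) \<subseteq> cubes_interior (cluster ?F 0)"
      using True by (intro interior_cube_subset self_in_cluster) simp
    ultimately have "{C \<in> components (cubes_interior ?F). interior (cube 1 0) \<subseteq> C} = {cubes_interior (cluster ?F 0)}"
      using * by blast
    then have "origin_component \<omega> = cubes_interior (cluster ?F 0)"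
      by (simp add: origin_component_def black_region_def)
    then show ?thesis using True by (simp add: cubes_in_cubes_interior)
  next
    case False
    then have "{C \<in> components (cubes_interior ?F). interior (cube 1 0) \<subseteq> C} = {}" using * by blast
    then have "origin_component \<omega> = \<Union>{}"
      unfolding origin_component_def black_region_def by (rule arg_cong)
    also have "\<dots> = cubes_interior {}" by (simp add: cubes_interior_def)
    finally show ?thesis using False by (simp add: cubes_in_cubes_interior)
  qed
qed

text \<open>An infinite set of sites is one that is unbounded in an enumeration of the lattice, which is a condition
  on countably many connection events.\<close>
lemma pred_infinite_cluster:
  "Measurable.pred (percolation p) (\<lambda>\<omega> :: int ^ 'd::finite \<Rightarrow> bool. infinite (cubes_in (origin_component \<omega>)))"
proof -
  have inf: "infinite A \<longleftrightarrow> (\<forall>n. \<exists>y. n \<le> to_nat y \<and> y \<in> A)" for A :: "(int ^ 'd) set"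
  proof -
    have "infinite A \<longleftrightarrow> infinite (to_nat ` A)" by (simp add: finite_image_iff)
    also have "\<dots> \<longleftrightarrow> (\<forall>n. \<exists>m\<ge>n. m \<in> to_nat ` A)" by (rule infinite_nat_iff_unbounded_le)
    also have "\<dots> \<longleftrightarrow> (\<forall>n. \<exists>y. n \<le> to_nat y \<and> y \<in> A)" by blast
    finally show ?thesis .
  qed
  have mem: "y \<in> cubes_in (origin_component \<omega>) \<longleftrightarrow> \<omega> 0 \<and> \<omega> y \<and> (0, y) \<in> (link (blacks \<omega>))\<^sup>*" for y \<omega>
    by (simp add: cubes_in_origin_component cluster_def)
  show ?thesis unfolding inf mem by measurable
qed

lemma infinite_sites: "infinite (UNIV :: (int ^ 'd::finite) set)"
proof
  assume "finite (UNIV :: (int ^ 'd) set)"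
  then have "finite (range (\<lambda>n :: int. (\<chi> i. n) :: int ^ 'd))" by (rule finite_subset[rotated]) auto
  moreover have "inj (\<lambda>n :: int. (\<chi> i. n) :: int ^ 'd)" by (auto simp: inj_on_def vec_eq_iff)
  ultimately show False using finite_imageD infinite_UNIV_char_0 by blast
qed

text \<open>This provides an element of the set whose infimum is the critical probability.\<close>
lemma percolation_prob_1: "percolation_prob TYPE('d::finite) 1 = 1"
proof -
  interpret prob_space "percolation 1 :: (int ^ 'd \<Rightarrow> bool) measure" by (rule prob_space_percolation)
  have black: "AE y in measure_pmf (bernoulli_pmf 1). y"
    unfolding AE_measure_pmf_iff by (auto simp: set_pmf_iff) (metis (full_types) diff_self pmf_bernoulli_False zero_le_one order_refl)
  have "AE \<omega> in percolation 1. \<omega> z" for z :: "int ^ 'd"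
    unfolding percolation_def
    by (rule AE_PiM_component[where M = "\<lambda>_. measure_pmf (bernoulli_pmf 1)" and P = "\<lambda>y. y"])
      (use black measure_pmf.prob_space_axioms in auto)
  then have "AE \<omega> in percolation 1. \<forall>z :: int ^ 'd. \<omega> z" by (simp add: AE_all_countable)
  then have "AE \<omega> in percolation 1. infinite (cubes_in (origin_component \<omega> :: (real ^ 'd) set))"
  proof (rule AE_mp, intro AE_I2 impI)
    fix \<omega> :: "int ^ 'd \<Rightarrow> bool" assume w: "\<forall>z. \<omega> z"
    have "cluster UNIV (0 :: int ^ 'd) = UNIV"
      using link_star_between[of 0 _ UNIV] by (auto simp: cluster_def)
    moreover have "blacks \<omega> = UNIV" using w by auto
    ultimately have "cubes_in (origin_component \<omega>) = UNIV"
      unfolding cubes_in_origin_component using w by metis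
    then show "infinite (cubes_in (origin_component \<omega>))" using infinite_sites by simp
  qed
  then show ?thesis
    unfolding percolation_prob_def
    using prob_Collect_eq_1[of "\<lambda>\<omega>. infinite (cubes_in (origin_component \<omega>))"]
      pred_infinite_cluster[of 1, where 'd = 'd] by (simp add: pred_def)
qed

text \<open>By definition of the infimum there is percolation at some \<open>q < p\<close>. An infinite cluster of the
  origin leaves every box; monotonicity brings this bound from \<open>q\<close> to \<open>p\<close>, and translation
  to an arbitrary site.\<close>
lemma arm_prob:
  assumes "critical_prob TYPE('d::finite) < p" "p \<le> 1"
  obtains \<theta> where "\<theta> > 0"
    "\<And>R (b :: int ^ 'd). 0 \<le> R \<Longrightarrow> measure (percolation p) {\<omega>. arm R b (blacks \<omega>)} \<ge> \<theta>" "0 < p"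
proof -
  have "{p \<in> {0..1}. percolation_prob TYPE('d) p > 0} \<noteq> {}" using percolation_prob_1[where 'd = 'd] by force
  from cInf_lessD[OF this] assms(1) obtain q where q: "0 \<le> q" "q \<le> 1" "q < p"
    and pos: "percolation_prob TYPE('d) q > 0"
    unfolding critical_prob_def by auto
  show ?thesis
  proof (rule that[OF pos])
    fix R :: int and b :: "int ^ 'd"
    interpret P: prob_space "percolation q :: (int ^ 'd \<Rightarrow> bool) measure" by (rule prob_space_percolation)
    interpret Pp: prob_space "percolation p :: (int ^ 'd \<Rightarrow> bool) measure" by (rule prob_space_percolation)
    have ev: "{\<omega>. arm R b (blacks \<omega>)} \<in> sets (percolation s)" for b :: "int ^ 'd" and s
      using pred_arm[of R b s] by (simp add: pred_def)
    have "percolation_prob TYPE('d) q \<le> P.prob {\<omega>. arm R 0 (blacks \<omega>)}"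
      unfolding percolation_prob_def
    proof (rule P.finite_measure_mono[OF _ ev], safe)
      fix \<omega> :: "int ^ 'd \<Rightarrow> bool" assume inf: "infinite (cubes_in (origin_component \<omega>))"
      then have "infinite (cluster (blacks \<omega>) 0)"
        by (simp add: cubes_in_origin_component split: if_splits)
      then have "\<not> cluster (blacks \<omega>) 0 \<subseteq> site_box R 0" using finite_site_box finite_subset by blast
      then show "arm R 0 (blacks \<omega>)" by (auto simp: arm_def cluster_def)
    qed
    also have "\<dots> \<le> Pp.prob {\<omega>. arm R 0 (blacks \<omega>)}"
      using q assms(2) by (intro measure_percolation_mono[OF _ _ _ ev]) (auto intro: arm_mono)
    also have "\<dots> = Pp.prob {\<omega>. (\<lambda>z. \<omega> (z + b)) \<in> {\<omega>. arm R 0 (blacks \<omega>)}}"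
      by (rule measure_percolation_translate(1)[OF ev, symmetric])
    also have "\<dots> \<le> Pp.prob {\<omega>. arm R b (blacks \<omega>)}"
    proof (rule Pp.finite_measure_mono[OF _ ev], safe)
      fix \<omega> :: "int ^ 'd \<Rightarrow> bool" assume "arm R 0 {z. \<omega> (z + b)}"
      then obtain y where y: "y \<notin> site_box R 0" "(0, y) \<in> (link {z. \<omega> (z + b)})\<^sup>*" by (auto simp: arm_def)
      from link_star_translate[OF y(2)] have "(b, y + b) \<in> (link (blacks \<omega>))\<^sup>*" by simp
      moreover have "y + b \<notin> site_box R b" using y(1) by (simp add: site_box_def)
      ultimately show "arm R b (blacks \<omega>)" by (auto simp: arm_def)
    qed
    finally show "percolation_prob TYPE('d) q \<le> Pp.prob {\<omega>. arm R b (blacks \<omega>)}" .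
  qed (use q in simp)
qed

section \<open>Walled boxes with many gadgets\<close>

text \<open>The upper corner stands for the whole sphere, which is connected, and it marks the position of
  the box.\<close>

definition corner :: "int \<Rightarrow> int ^ 'd::finite \<Rightarrow> int ^ 'd" where
  "corner R x = (\<chi> i. x $ i + R)"

lemma corner_in_sphere: "0 \<le> R \<Longrightarrow> corner R x \<in> sphere_at R x"
  by (auto simp: corner_def shell_def site_box_def)

lemma site_box_mono: "r \<le> r' \<Longrightarrow> site_box r b \<subseteq> site_box r' b"
  unfolding site_box_def by (auto intro: order_trans)

lemma site_box_adjacent: "z \<in> site_box r b \<Longrightarrow> adjacent z w \<Longrightarrow> w \<in> site_box (r + 1) b"
  unfolding site_box_def using adjacent_diff_le[of z w] by (smt (verit) mem_Collect_eq)

lemma sphere_site_box: "sphere_at r b \<subseteq> site_box r b"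
  by (auto simp: shell_def)

text \<open>Here \<open>F\<close> is the set of black sites before the gadget and the sphere are imposed, and \<open>F'\<close> is
  the set afterwards. A path from \<open>b\<close> in \<open>F\<close> may run through the gadget and be destroyed there. But
  whenever it comes out, it does so next to the hull, and all sites of the hull are
  connected to the exit site. So each site that the path visits, before
  it meets the sphere, is in the gadget or connected to the exit site in \<open>F'\<close>. A path that is long
  enough has to meet the sphere.\<close>

lemma exit_connected_to_corner:
  fixes b x :: "int ^ 'd::finite"
  assumes d: "CARD('d) \<ge> 2" and R: "0 \<le> R"
    and gadget: "has_gadget \<sigma> k F' b" and inside: "site_box (int k + 4) b \<subseteq> site_box (R - 1) x"
    and sphere: "sphere_at R x \<subseteq> F'"
    and same: "\<And>z. z \<in> site_box (R - 1) x \<Longrightarrow> z \<notin> site_box (int k + 4) b \<Longrightarrow> z \<in> F \<longleftrightarrow> z \<in> F'"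
    and arm: "arm (2 * R) b F"
  shows "(exit_site \<sigma> k b, corner R x) \<in> (link F')\<^sup>*"
proof -
  let ?g = "int k + 4" and ?e = "exit_site \<sigma> k b"
  have gF': "gadget_sites \<sigma> k b \<subseteq> F'" using gadget by (auto simp: has_gadget_def)
  have outer: "sphere_at ?g b \<subseteq> F'" using gF' by (auto simp: gadget_sites_def)
  have e: "?e \<in> sphere_at ?g b"
    by (auto simp: exit_site_def shell_def site_box_def axis_nth intro!: exI[of _ "\<sigma> 0"])
  obtain y where y: "y \<notin> site_box (2 * R) b" "(b, y) \<in> (link F)\<^sup>*" using arm by (auto simp: arm_def)
  let ?done = "\<exists>w\<in>sphere_at R x. (?e, w) \<in> (link F')\<^sup>*"
  have b_in: "b \<in> site_box ?g b" by (simp add: site_box_def)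
  have "?done \<or> (z \<in> site_box (R - 1) x \<and> (z \<in> site_box ?g b \<or> (?e, z) \<in> (link F')\<^sup>*))"
    if "(b, z) \<in> (link F)\<^sup>*" for z
    using that
  proof (induction rule: rtrancl_induct)
    case base
    then show ?case using b_in inside by blast
  next
    case (step z z')
    have adj: "adjacent z z'" "z' \<in> F" using step.hyps(2) by (auto simp: link_def)
    show ?case
    proof (cases "?done")
      case False
      with step.IH have z: "z \<in> site_box (R - 1) x" "z \<in> site_box ?g b \<or> (?e, z) \<in> (link F')\<^sup>*" by auto
      show ?thesis
      proof (cases "z' \<in> site_box ?g b")
        case True
        then show ?thesis using inside by blast
      next
        case out: False
        have z'R: "z' \<in> site_box R x" using site_box_adjacent[OF z(1) adj(1)] by simp
        have z'F: "z' \<in> F'"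
        proof (cases "z' \<in> site_box (R - 1) x")
          case True
          then show ?thesis using same[OF True out] adj(2) by simp
        next
          case False
          then have "z' \<in> sphere_at R x" using z'R by (simp add: mem_sphere_at)
          then show ?thesis using sphere by blast
        qed
        have ez: "(?e, z) \<in> (link F')\<^sup>*"
        proof (cases "z \<in> site_box ?g b")
          case True
          have "z \<notin> site_box (?g - 1) b" using site_box_adjacent[OF _ adj(1), of "?g - 1" b] out
            by (auto simp: add.commute)
          then have "z \<in> sphere_at ?g b" using True by (simp add: mem_sphere_at)
          then have "(?e, z) \<in> (link (sphere_at ?g b))\<^sup>*"
            using d e by (intro shell_connected) auto
          then show ?thesis using outer by (rule link_star_mono)
        qed (use z in auto)
        then have "z \<in> F'" using link_star_mem e outer by blast
        then have "(z, z') \<in> link F'" using z'F adj(1) by (simp add: link_def)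
        with ez have ez': "(?e, z') \<in> (link F')\<^sup>*" by (rule rtrancl_into_rtrancl)
        show ?thesis
        proof (cases "z' \<in> site_box (R - 1) x")
          case False
          then have "z' \<in> sphere_at R x" using z'R by (simp add: mem_sphere_at)
          then show ?thesis using ez' by blast
        qed (use ez' in blast)
      qed
    qed simp
  qed
  from this[OF y(2)] have "?done \<or> y \<in> site_box (R - 1) x" by blast
  moreover have "y \<notin> site_box (R - 1) x"
  proof
    assume yx: "y \<in> site_box (R - 1) x"
    have bx: "b \<in> site_box (R - 1) x" using b_in inside by blast
    have "\<bar>y $ i - b $ i\<bar> \<le> 2 * R" for i
    proof -
      have "\<bar>y $ i - x $ i\<bar> \<le> R - 1" "\<bar>b $ i - x $ i\<bar> \<le> R - 1" using yx bx by (auto simp: site_box_def)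
      then show ?thesis by linarith
    qed
    then show False using y(1) by (simp add: site_box_def)
  qed
  ultimately obtain w where w: "w \<in> sphere_at R x" "(?e, w) \<in> (link F')\<^sup>*" by blast
  have "(w, corner R x) \<in> (link (sphere_at R x))\<^sup>*"
    using d R w(1) corner_in_sphere[OF R, of x] by (intro shell_connected) auto
  then have "(w, corner R x) \<in> (link F')\<^sup>*" using sphere by (rule link_star_mono)
  with w(2) show ?thesis by (rule rtrancl_trans)
qed

definition wall :: "int \<Rightarrow> int ^ 'd::finite \<Rightarrow> (int ^ 'd) set" where
  "wall R x = sphere_at R x \<union> sphere_at (R + 1) x"

text \<open>Overwriting the colours on the wall with membership in the inner sphere makes its inner layer black
  and its outer layer white.\<close>
definition walled :: "int \<Rightarrow> int ^ 'd::finite \<Rightarrow> (int ^ 'd \<Rightarrow> bool) \<Rightarrow> int ^ 'd \<Rightarrow> bool" where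
  "walled R x \<omega> = override_on \<omega> (\<lambda>z. z \<in> sphere_at R x) (wall R x)"

definition attached :: "(nat \<Rightarrow> 'd::finite) \<Rightarrow> nat \<Rightarrow> int \<Rightarrow> int ^ 'd \<Rightarrow> int ^ 'd \<Rightarrow> (int ^ 'd) set \<Rightarrow> bool" where
  "attached \<sigma> k R x b F \<longleftrightarrow> has_gadget \<sigma> k F b \<and> (exit_site \<sigma> k b, corner R x) \<in> (link F)\<^sup>*"

lemma wall_disjoint: "0 \<le> R \<Longrightarrow> z \<in> site_box (R - 1) x \<Longrightarrow> z \<notin> wall R x"
  using site_box_mono[of "R - 1" R x] by (auto simp: wall_def mem_sphere_at)

lemma finite_wall: "finite (wall R x)"
  using finite_site_box sphere_site_box finite_subset unfolding wall_def by (metis finite_UnI)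

lemma pred_attached: "Measurable.pred (percolation p) (\<lambda>\<omega>. attached \<sigma> k R x b (blacks \<omega>))"
proof -
  have "Measurable.pred (percolation p) (\<lambda>\<omega>. has_gadget \<sigma> k (blacks \<omega>) b)"
    by (rule pred_finite_dependence[OF finite_site_box[of "int k + 4" b]]) (auto simp: has_gadget_def set_eq_iff)
  then show ?thesis unfolding attached_def by measurable
qed

lemma sets_attached: "{\<omega>. attached \<sigma> k R x b (blacks \<omega>)} \<in> sets (percolation p)"
  using pred_attached[where p = p] by (simp add: pred_def)

lemma walled_measurable: "walled R x \<in> measurable (percolation p) (percolation p)"
  unfolding walled_def[abs_def] by (rule measurable_override_on)

lemma sets_walled:
  assumes "A \<in> sets (percolation p)"
  shows "{\<omega>. walled R x \<omega> \<in> A} \<in> sets (percolation p)"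
  using measurable_sets[OF walled_measurable assms] by (simp add: vimage_def)

text \<open>The gadget and the connection of its hull to the wall concern disjoint sets of sites once the colours
  inside the gadget are overwritten, and the connection then holds whenever \<open>b\<close> has a long
  path in the original colouring.\<close>
lemma prob_attached:
  fixes b x :: "int ^ 'd::finite"
  assumes d: "CARD('d) \<ge> 2" and R: "0 \<le> R" and p: "0 \<le> p" "p \<le> 1"
    and inside: "site_box (int k + 4) b \<subseteq> site_box (R - 1) x"
    and \<theta>: "measure (percolation p) {\<omega>. arm (2 * R) b (blacks \<omega>)} \<ge> \<theta>" "0 \<le> \<theta>"
  shows "measure (percolation p) {\<omega>. attached \<sigma> k R x b (blacks (walled R x \<omega>))} \<ge>
    min p (1 - p) ^ card (site_box (int k + 4) b) * \<theta>"
proof -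
  let ?P = "percolation p :: (int ^ 'd \<Rightarrow> bool) measure"
  interpret prob_space ?P by (rule prob_space_percolation)
  let ?T = "site_box (int k + 4) b" and ?\<eta> = "\<lambda>z. z \<in> gadget_sites \<sigma> k b"
  define A where "A = {\<omega>. walled R x \<omega> \<in> {\<omega>. (exit_site \<sigma> k b, corner R x) \<in> (link (blacks \<omega>))\<^sup>*}}"
  have A: "A \<in> sets ?P" unfolding A_def
    by (rule sets_walled) (use pred_link[where p = p] in \<open>simp add: pred_def\<close>)
  have gadget: "has_gadget \<sigma> k (blacks (walled R x \<omega>)) b" if "agrees ?T ?\<eta> \<omega>" for \<omega>
  proof -
    have "walled R x \<omega> z = \<omega> z" if "z \<in> ?T" for z
      using that inside wall_disjoint[OF R] by (auto simp: walled_def override_on_def)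
    then show ?thesis using that gadget_sites_subset[of \<sigma> k b]
      by (auto simp: has_gadget_def agrees_def)
  qed
  have "min p (1 - p) ^ card ?T * \<theta> \<le> prob {\<omega>. agrees ?T ?\<eta> \<omega>} * prob {\<omega>. override_on \<omega> ?\<eta> ?T \<in> A}"
  proof (rule mult_mono)
    show "min p (1 - p) ^ card ?T \<le> prob {\<omega>. agrees ?T ?\<eta> \<omega>}"
      using finite_site_box p by (rule prob_agrees_ge)
    have "prob {\<omega>. arm (2 * R) b (blacks \<omega>)} \<le> prob {\<omega>. override_on \<omega> ?\<eta> ?T \<in> A}"
    proof (rule finite_measure_mono)
      show "{\<omega>. override_on \<omega> ?\<eta> ?T \<in> A} \<in> events"
        using measurable_sets[OF measurable_override_on A] by (simp add: vimage_def)
      show "{\<omega>. arm (2 * R) b (blacks \<omega>)} \<subseteq> {\<omega>. override_on \<omega> ?\<eta> ?T \<in> A}"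
      proof safe
        fix \<omega> assume arm: "arm (2 * R) b (blacks \<omega>)"
        let ?\<omega>' = "override_on \<omega> ?\<eta> ?T"
        have "(exit_site \<sigma> k b, corner R x) \<in> (link (blacks (walled R x ?\<omega>')))\<^sup>*"
        proof (rule exit_connected_to_corner[OF d R _ inside _ _ arm])
          show "has_gadget \<sigma> k (blacks (walled R x ?\<omega>')) b"
            by (rule gadget) (simp add: agrees_def)
          show "sphere_at R x \<subseteq> blacks (walled R x ?\<omega>')"
            by (auto simp: walled_def wall_def)
          show "z \<in> blacks \<omega> \<longleftrightarrow> z \<in> blacks (walled R x ?\<omega>')"
            if "z \<in> site_box (R - 1) x" "z \<notin> ?T" for z
            using that wall_disjoint[OF R] by (auto simp: walled_def override_on_def)
        qed
        then show "?\<omega>' \<in> A" by (simp add: A_def)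
      qed
    qed
    then show "\<theta> \<le> prob {\<omega>. override_on \<omega> ?\<eta> ?T \<in> A}" using \<theta>(1) by linarith
  qed (use \<theta> in auto)
  also have "\<dots> = prob {\<omega>. agrees ?T ?\<eta> \<omega> \<and> override_on \<omega> ?\<eta> ?T \<in> A}"
    using finite_site_box A by (rule prob_agrees_indep[symmetric])
  also have "\<dots> \<le> prob {\<omega>. attached \<sigma> k R x b (blacks (walled R x \<omega>))}"
  proof (rule finite_measure_mono)
    show "{\<omega>. attached \<sigma> k R x b (blacks (walled R x \<omega>))} \<in> events"
      using sets_walled[OF sets_attached, of R x] by simp
    show "{\<omega>. agrees ?T ?\<eta> \<omega> \<and> override_on \<omega> ?\<eta> ?T \<in> A} \<subseteq> {\<omega>. attached \<sigma> k R x b (blacks (walled R x \<omega>))}"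
    proof safe
      fix \<omega> assume *: "agrees ?T ?\<eta> \<omega>" "override_on \<omega> ?\<eta> ?T \<in> A"
      have "override_on \<omega> ?\<eta> ?T = \<omega>" using *(1) by (auto simp: override_on_def agrees_def)
      then show "attached \<sigma> k R x b (blacks (walled R x \<omega>))"
        using * gadget by (simp add: attached_def A_def)
    qed
  qed
  finally show ?thesis .
qed

text \<open>The spacing is the side of a gadget, so that the gadgets at different sites of the grid are disjoint.
  The radius of the box is the least one for which all gadgets lie strictly
  inside the wall.\<close>
definition grid :: "nat \<Rightarrow> nat \<Rightarrow> int ^ 'd::finite \<Rightarrow> (int ^ 'd) set" where
  "grid k J x = (\<lambda>j. \<chi> i. x $ i + (2 * int k + 9) * j $ i) ` site_box (int J) 0"

definition radius :: "nat \<Rightarrow> nat \<Rightarrow> int" where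
  "radius k J = (2 * int k + 9) * int J + int k + 5"

lemma radius_pos: "0 \<le> radius k J" by (simp add: radius_def)

lemma finite_grid: "finite (grid k J x)"
  unfolding grid_def by (intro finite_imageI finite_site_box)

lemma card_grid: "card (grid k J (x :: int ^ 'd::finite)) = (2 * J + 1) ^ CARD('d)"
proof -
  have "inj_on (\<lambda>j. \<chi> i. x $ i + (2 * int k + 9) * j $ i) (site_box (int J) 0)"
    by (auto simp: inj_on_def vec_eq_iff)
  then show ?thesis unfolding grid_def
    by (simp add: card_image card_site_box nat_add_distrib nat_mult_distrib)
qed

lemma grid_inside:
  assumes "b \<in> grid k J x"
  shows "site_box (int k + 4) b \<subseteq> site_box (radius k J - 1) x"
proof
  fix z assume z: "z \<in> site_box (int k + 4) b"
  obtain j where j: "j \<in> site_box (int J) 0" "b = (\<chi> i. x $ i + (2 * int k + 9) * j $ i)"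
    using assms by (auto simp: grid_def)
  have "\<bar>z $ i - x $ i\<bar> \<le> radius k J - 1" for i
  proof -
    have "\<bar>z $ i - b $ i\<bar> \<le> int k + 4" using z by (simp add: site_box_def)
    moreover have "\<bar>b $ i - x $ i\<bar> \<le> (2 * int k + 9) * int J"
    proof -
      have "(2 * int k + 9) * \<bar>j $ i\<bar> \<le> (2 * int k + 9) * int J"
        using j(1) by (intro mult_left_mono) (auto simp: site_box_def)
      then show ?thesis by (simp add: j(2) abs_mult)
    qed
    ultimately show ?thesis unfolding radius_def by linarith
  qed
  then show "z \<in> site_box (radius k J - 1) x" by (simp add: site_box_def)
qed

lemma grid_separated:
  assumes "b \<in> grid k J x" "b' \<in> grid k J x" "b \<noteq> b'"
  shows "\<exists>i. \<bar>b $ i - b' $ i\<bar> \<ge> 2 * int k + 7"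
proof -
  obtain j where j: "b = (\<chi> i. x $ i + (2 * int k + 9) * j $ i)" using assms by (auto simp: grid_def)
  obtain j' where j': "b' = (\<chi> i. x $ i + (2 * int k + 9) * j' $ i)" using assms by (auto simp: grid_def)
  from assms(3) obtain i where i: "j $ i \<noteq> j' $ i" by (auto simp: j j' vec_eq_iff)
  have "b $ i - b' $ i = (2 * int k + 9) * (j $ i - j' $ i)" by (simp add: j j' algebra_simps)
  then have "\<bar>b $ i - b' $ i\<bar> = (2 * int k + 9) * \<bar>j $ i - j' $ i\<bar>" by (simp add: abs_mult)
  moreover have "(2 * int k + 9) * 1 \<le> (2 * int k + 9) * \<bar>j $ i - j' $ i\<bar>"
    using i by (intro mult_left_mono) auto
  ultimately have "2 * int k + 9 \<le> \<bar>b $ i - b' $ i\<bar>" by simp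
  then show ?thesis by (intro exI[of _ i]) linarith
qed

definition good :: "(nat \<Rightarrow> 'd::finite) \<Rightarrow> nat \<Rightarrow> nat \<Rightarrow> real \<Rightarrow> int ^ 'd \<Rightarrow> (int ^ 'd \<Rightarrow> bool) \<Rightarrow> bool" where
  "good \<sigma> k J m x \<omega> \<longleftrightarrow> agrees (wall (radius k J) x) (\<lambda>z. z \<in> sphere_at (radius k J) x) \<omega> \<and>
     real (card {b \<in> grid k J x. attached \<sigma> k (radius k J) x b (blacks \<omega>)}) \<ge> m"

lemma sets_many_attached:
  "{\<omega>. m \<le> real (card {b \<in> grid k J x. attached \<sigma> k R x b (blacks \<omega>)})} \<in> sets (percolation p)"
  using sets_card_ge[where I = "grid k J x" and A = "\<lambda>b. {\<omega>. attached \<sigma> k R x b (blacks \<omega>)}"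
      and M = "percolation p" and m = m, OF finite_grid sets_attached] by simp

lemma sets_good: "{\<omega>. good \<sigma> k J m x \<omega>} \<in> sets (percolation p)"
proof -
  have "{\<omega>. agrees (wall (radius k J) x) (\<lambda>z. z \<in> sphere_at (radius k J) x) \<omega>} \<in> sets (percolation p)"
    using pred_agrees[OF finite_wall, where p = p] by (simp add: pred_def)
  then have "{\<omega>. agrees (wall (radius k J) x) (\<lambda>z. z \<in> sphere_at (radius k J) x) \<omega>} \<inter>
    {\<omega>. m \<le> real (card {b \<in> grid k J x. attached \<sigma> k (radius k J) x b (blacks \<omega>)})} \<in> sets (percolation p)"
    by (intro sets.Int sets_many_attached)
  then show ?thesis by (simp add: good_def Int_def)
qed

text \<open>The number \<open>(2 * k + 9) ^ CARD('d)\<close> counts the sites that determine a gadget, so \<open>q\<close> is a lower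
  bound, uniform in the size of the box, for the probability that a given gadget is present and
  attached.\<close>
lemma prob_good:
  fixes x :: "int ^ 'd::finite"
  assumes d: "CARD('d) \<ge> 2" and p: "0 \<le> p" "p \<le> 1"
    and \<theta>: "\<And>b :: int ^ 'd. measure (percolation p) {\<omega>. arm (2 * radius k J) b (blacks \<omega>)} \<ge> \<theta>" "0 \<le> \<theta>"
    and q: "q = min p (1 - p) ^ ((2 * k + 9) ^ CARD('d)) * \<theta>"
  shows "measure (percolation p) {\<omega>. good \<sigma> k J (q / 2 * (2 * J + 1) ^ CARD('d)) x \<omega>} \<ge>
    min p (1 - p) ^ card (wall (radius k J) x) * (q / 2)"
proof -
  let ?P = "percolation p :: (int ^ 'd \<Rightarrow> bool) measure" and ?R = "radius k J"
  interpret prob_space ?P by (rule prob_space_percolation)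
  let ?m = "q / 2 * (2 * J + 1) ^ CARD('d)"
  let ?\<eta> = "\<lambda>z. z \<in> sphere_at ?R x" and ?S = "wall ?R x"
  have card_T: "card (site_box (int k + 4) b :: (int ^ 'd) set) = (2 * k + 9) ^ CARD('d)" for b
    by (simp add: card_site_box nat_add_distrib nat_mult_distrib add.commute)
  define A where "A = {\<omega>. ?m \<le> real (card {b \<in> grid k J x. attached \<sigma> k ?R x b (blacks \<omega>)})}"
  have A: "A \<in> events" unfolding A_def by (rule sets_many_attached)
  have q0: "0 \<le> q" using q p \<theta>(2) by simp
  have "q / 2 \<le> prob {\<omega> \<in> space ?P. q / 2 * card (grid k J x) \<le>
      real (card {b \<in> grid k J x. \<omega> \<in> {\<omega>. attached \<sigma> k ?R x b (blacks (walled ?R x \<omega>))}})}"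
  proof (rule prob_many_events_ge[OF finite_grid])
    fix b assume b: "b \<in> grid k J x"
    show "{\<omega>. attached \<sigma> k ?R x b (blacks (walled ?R x \<omega>))} \<in> events"
      using sets_walled[OF sets_attached, of ?R x] by simp
    show "q \<le> prob {\<omega>. attached \<sigma> k ?R x b (blacks (walled ?R x \<omega>))}"
      using prob_attached[OF d radius_pos p grid_inside[OF b] \<theta>(1) \<theta>(2), of \<sigma>] by (simp add: q card_T)
  next
    have "card (grid k J x) \<noteq> 0" by (simp add: card_grid)
    then show "grid k J x \<noteq> {}" by auto
  qed (fact q0)
  also have "\<dots> = prob {\<omega>. override_on \<omega> ?\<eta> ?S \<in> A}"
    by (simp add: A_def card_grid walled_def)
  finally have B: "q / 2 \<le> prob {\<omega>. override_on \<omega> ?\<eta> ?S \<in> A}" .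
  have "min p (1 - p) ^ card ?S * (q / 2) \<le> prob {\<omega>. agrees ?S ?\<eta> \<omega>} * prob {\<omega>. override_on \<omega> ?\<eta> ?S \<in> A}"
    using prob_agrees_ge[OF finite_wall p] B q0 by (intro mult_mono) auto
  also have "\<dots> = prob {\<omega>. agrees ?S ?\<eta> \<omega> \<and> override_on \<omega> ?\<eta> ?S \<in> A}"
    using finite_wall A by (rule prob_agrees_indep[symmetric])
  also have "\<dots> \<le> prob {\<omega>. good \<sigma> k J ?m x \<omega>}"
  proof (rule finite_measure_mono[OF _ sets_good], safe)
    fix \<omega> assume *: "agrees ?S ?\<eta> \<omega>" "override_on \<omega> ?\<eta> ?S \<in> A"
    have "override_on \<omega> ?\<eta> ?S = \<omega>" using *(1) by (auto simp: override_on_def agrees_def)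
    then show "good \<sigma> k J ?m x \<omega>" using * by (simp add: good_def A_def)
  qed
  finally show ?thesis .
qed

definition good_cluster :: "nat \<Rightarrow> nat \<Rightarrow> int ^ 'd::finite \<Rightarrow> (int ^ 'd \<Rightarrow> bool) \<Rightarrow> (int ^ 'd) set" where
  "good_cluster k J x \<omega> = cluster (blacks \<omega>) (corner (radius k J) x)"

text \<open>The white layer of the wall confines the cluster to the box; the attached gadgets provide the
  homology.\<close>
lemma good_cluster:
  fixes x :: "int ^ 'd::finite"
  assumes good: "good \<sigma> k J m x \<omega>" and k: "0 < k" and \<sigma>: "inj_on \<sigma> {..k}"
  shows "good_cluster k J x \<omega> \<subseteq> site_box (radius k J) x"
    and "corner (radius k J) x \<in> good_cluster k J x \<omega>"
    and "cubes_interior (good_cluster k J x \<omega>) \<in> components (black_region \<omega>)"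
    and "cubes_interior (good_cluster k J x \<omega>) \<in> finite_complexes"
    and "real n \<le> m \<Longrightarrow> enat n \<le> betti k (cubes_interior (good_cluster k J x \<omega>))"
proof -
  let ?R = "radius k J" and ?F = "blacks \<omega>" and ?c = "corner (radius k J) x"
  let ?K = "good_cluster k J x \<omega>"
  have wall: "\<omega> z \<longleftrightarrow> z \<in> sphere_at ?R x" if "z \<in> wall ?R x" for z
    using good that by (auto simp: good_def agrees_def)
  have c: "?c \<in> sphere_at ?R x" by (rule corner_in_sphere[OF radius_pos])
  then have cF: "?c \<in> ?F" using wall[of ?c] by (auto simp: wall_def)
  then show cK: "?c \<in> ?K" by (simp add: good_cluster_def self_in_cluster)
  have "z \<in> site_box ?R x" if "(?c, z) \<in> (link ?F)\<^sup>*" for z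
    using that
  proof (induction rule: rtrancl_induct)
    case base
    then show ?case using c sphere_site_box by blast
  next
    case (step y z)
    then have z: "\<omega> z" "z \<in> site_box (?R + 1) x" using site_box_adjacent by (auto simp: link_def)
    show ?case
    proof (rule ccontr)
      assume out: "z \<notin> site_box ?R x"
      then have "z \<in> sphere_at (?R + 1) x" using z by (simp add: mem_sphere_at)
      then have "z \<in> sphere_at ?R x" using wall[of z] z by (simp add: wall_def)
      then show False using out sphere_site_box by blast
    qed
  qed
  then show sub: "?K \<subseteq> site_box ?R x" by (auto simp: good_cluster_def cluster_def)
  show comp: "cubes_interior ?K \<in> components (black_region \<omega>)"
    using cF by (auto simp: black_region_def components_cubes_interior good_cluster_def)
  have "finite ?K" using sub finite_site_box finite_subset by blast
  then show "cubes_interior ?K \<in> finite_complexes"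
    using in_components_nonempty[OF comp] in_components_connected[OF comp]
    by (auto simp: finite_complexes_def)
  assume n: "real n \<le> m"
  let ?B = "{b \<in> grid k J x. attached \<sigma> k ?R x b ?F}"
  have "n \<le> card ?B" using good n by (simp add: good_def)
  then have "enat n \<le> enat (card ?B)" by simp
  also have "\<dots> \<le> betti k (cubes_interior ?K)"
  proof (rule card_gadgets_le_betti[OF k \<sigma>, of _ _ ?F])
    show "finite ?B" by (rule finite_subset[OF _ finite_grid[of k J x]]) auto
    show "?K \<subseteq> ?F" unfolding good_cluster_def by (rule cluster_subset)
    show "has_gadget \<sigma> k ?F b" if "b \<in> ?B" for b using that by (simp add: attached_def)
    show "ring_sites \<sigma> k b \<subseteq> ?K" if "b \<in> ?B" for b
    proof
      fix z assume z: "z \<in> ring_sites \<sigma> k b"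
      have "has_gadget \<sigma> k ?F b" "(exit_site \<sigma> k b, ?c) \<in> (link ?F)\<^sup>*"
        using that by (auto simp: attached_def)
      then have "(?c, z) \<in> (link ?F)\<^sup>*"
        using ring_connected_to_exit[OF k \<sigma> _ z] link_star_sym rtrancl_trans by metis
      then show "z \<in> ?K" using link_star_mem cF by (auto simp: good_cluster_def cluster_def)
    qed
    show "\<exists>i. \<bar>b $ i - b' $ i\<bar> \<ge> 2 * int k + 7" if "b \<in> ?B" "b' \<in> ?B" "b \<noteq> b'" for b b'
      using that grid_separated by blast
  qed
  finally show "enat n \<le> betti k (cubes_interior ?K)" .
qed

text \<open>The box can be recovered from the cluster: the cluster reaches the upper corner of the box but not
  beyond the box in any coordinate.\<close>
lemma good_cluster_inj:
  assumes good: "good \<sigma> k J m x \<omega>" "good \<sigma> k J m y \<omega>" and k: "0 < k" and \<sigma>: "inj_on \<sigma> {..k}"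
    and eq: "good_cluster k J x \<omega> = good_cluster k J y \<omega>"
  shows "x = y"
proof -
  have le: "y $ i \<le> x $ i" if "corner (radius k J) y \<in> site_box (radius k J) x" for x y :: "int ^ 'd" and i
  proof -
    have "\<bar>y $ i + radius k J - x $ i\<bar> \<le> radius k J"
      using that by (simp add: site_box_def corner_def)
    then show ?thesis by linarith
  qed
  have "corner (radius k J) y \<in> site_box (radius k J) x" "corner (radius k J) x \<in> site_box (radius k J) y"
    using good_cluster(1,2)[OF good(1) k \<sigma>] good_cluster(1,2)[OF good(2) k \<sigma>] eq by blast+
  then show ?thesis using le[of x y] le[of y x] by (auto simp: vec_eq_iff intro: antisym)
qed

section \<open>Comparison with the limit law\<close>

lemma abs_diff_le_tv_dist: "\<bar>measure_pmf.prob P A - measure_pmf.prob Q A\<bar> \<le> tv_dist P Q"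
  unfolding tv_dist_def
proof (rule cSUP_upper)
  show "bdd_above (range (\<lambda>A. \<bar>measure_pmf.prob P A - measure_pmf.prob Q A\<bar>))"
  proof (rule bdd_aboveI2)
    fix A
    show "\<bar>measure_pmf.prob P A - measure_pmf.prob Q A\<bar> \<le> 1"
      using measure_pmf.prob_le_1[of P A] measure_pmf.prob_le_1[of Q A]
        measure_nonneg[of "measure_pmf P" A] measure_nonneg[of "measure_pmf Q" A] by linarith
  qed
qed simp

lemma sets_tv_event:
  "{\<omega> :: int ^ 'd::finite \<Rightarrow> bool. tv_dist (empirical_law \<nu> L \<omega>) \<mu> > \<epsilon>} \<in> sets (percolation p)"
proof -
  have "Measurable.pred (percolation p) (\<lambda>\<omega> :: int ^ 'd \<Rightarrow> bool. tv_dist (empirical_law \<nu> L \<omega>) \<mu> > \<epsilon>)"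
  proof (rule pred_finite_dependence)
    show "finite (\<Union>v\<in>window_sites L. site_box 1 v :: (int ^ 'd) set)"
      using finite_window_sites finite_site_box by blast
    fix \<omega> \<omega>' :: "int ^ 'd \<Rightarrow> bool"
    assume "\<And>z. z \<in> (\<Union>v\<in>window_sites L. site_box 1 v) \<Longrightarrow> \<omega> z = \<omega>' z"
    then have "black_region_in L \<omega> = black_region_in L \<omega>'"
      by (intro black_region_in_cong) (auto simp: site_box_def)
    then show "(tv_dist (empirical_law \<nu> L \<omega>) \<mu> > \<epsilon>) = (tv_dist (empirical_law \<nu> L \<omega>') \<mu> > \<epsilon>)"
      by (simp add: empirical_law_def b0_def)
  qed
  then show ?thesis by (simp add: pred_def)
qed

lemma htpy_type_in_betti_ge:
  assumes "C \<in> finite_complexes" "enat n \<le> betti k C"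
  shows "htpy_type C \<in> betti_ge k n"
proof -
  have 1: "htpy_type C \<in> htpy_types" using assms(1) by (simp add: htpy_type_def htpy_types_def quotientI)
  have "C \<in> htpy_type C"
    using equiv_class_self[OF equiv_htpy_rel assms(1)] by (simp add: htpy_type_def)
  then show ?thesis using 1 assms(2) betti_type_eq[OF 1] by (simp add: betti_ge_def)
qed

lemma cubes_interior_in_window:
  assumes K: "K \<subseteq> site_box R x" and x: "\<And>i. - (int L div 2) + R \<le> x $ i \<and> x $ i < int L - int L div 2 - R"
  shows "cubes_interior K \<subseteq> window L"
proof
  fix y assume "y \<in> cubes_interior K"
  then have "site y \<in> site_box R x" using site_of_cubes_interior K by blast
  then have s: "\<bar>\<lfloor>y $ i\<rfloor> - x $ i\<bar> \<le> R" for i by (simp add: site_box_def)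
  show "y \<in> window L"
    unfolding mem_window
  proof
    fix i
    show "- of_int (int L div 2) \<le> y $ i \<and> y $ i \<le> of_int (int L - int L div 2)"
    proof
      have "- (int L div 2) \<le> \<lfloor>y $ i\<rfloor>" using s[of i] x[of i] by linarith
      then show "- of_int (int L div 2) \<le> y $ i" by linarith
      have "\<lfloor>y $ i\<rfloor> + 1 \<le> int L - int L div 2" using s[of i] x[of i] by linarith
      then show "y $ i \<le> of_int (int L - int L div 2)" by linarith
    qed
  qed
qed

text \<open>The good boxes in the window have pairwise different components with Betti number at least \<open>n\<close>,
  out of at most \<open>L ^ CARD('d)\<close> components in the window.\<close>
lemma empirical_law_ge:
  fixes \<omega> :: "int ^ 'd::finite \<Rightarrow> bool"
  assumes k: "0 < k" and \<sigma>: "inj_on \<sigma> {..k}" and n: "real n \<le> m"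
    and I: "I = {x. \<forall>i. - (int L div 2) + radius k J \<le> x $ i \<and> x $ i < int L - int L div 2 - radius k J}"
    and N: "N = card {x \<in> I. good \<sigma> k J m x \<omega>}" "N > 0"
  shows "real N / real L ^ CARD('d) \<le> measure_pmf.prob (empirical_law \<nu> L \<omega>) (betti_ge k n)"
proof -
  let ?K = "components (black_region_in L \<omega>)"
  let ?C = "\<lambda>x. cubes_interior (good_cluster k J x \<omega>)"
  let ?G = "{x \<in> I. good \<sigma> k J m x \<omega>}"
  note gc = good_cluster[OF _ k \<sigma>]
  have inj: "inj_on ?C ?G"
  proof (rule inj_onI)
    fix x y assume xy: "x \<in> ?G" "y \<in> ?G" "?C x = ?C y"
    then have "good_cluster k J x \<omega> = good_cluster k J y \<omega>" by (metis cubes_in_cubes_interior)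
    then show "x = y" using xy good_cluster_inj[OF _ _ k \<sigma>] by blast
  qed
  have sub: "?C ` ?G \<subseteq> {C \<in> ?K. htpy_type C \<in> betti_ge k n}"
  proof safe
    fix x assume x: "x \<in> I" "good \<sigma> k J m x \<omega>"
    show "?C x \<in> ?K"
      unfolding components_black_region_in
      using gc(3)[OF x(2)] cubes_interior_in_window[OF gc(1)[OF x(2)], of L] x(1) I by blast
    show "htpy_type (?C x) \<in> betti_ge k n"
      using gc(4,5)[OF x(2)] n by (intro htpy_type_in_betti_ge) auto
  qed
  have fin: "finite ?K" by (rule finite_components_black_region_in)
  have NK: "N \<le> card {C \<in> ?K. htpy_type C \<in> betti_ge k n}"
    using card_mono[OF _ sub] fin inj by (simp add: card_image N(1))
  also have "\<dots> \<le> card ?K" using fin by (intro card_mono) auto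
  finally have b: "b0 L \<omega> > 0" using N(2) by (simp add: b0_def)
  have "0 < L ^ CARD('d)" using b b0_le[of L \<omega>] by linarith
  then have "real N / real L ^ CARD('d) \<le> real N / real (b0 L \<omega>)"
    using b b0_le[of L \<omega>] unfolding of_nat_power[symmetric]
    by (intro divide_left_mono mult_pos_pos) (simp_all only: of_nat_le_iff of_nat_0_less_iff of_nat_0_le_iff)
  also have "\<dots> \<le> 1 / real (b0 L \<omega>) * real (card {C \<in> ?K. htpy_type C \<in> betti_ge k n})"
    using NK by (simp add: divide_right_mono)
  also have "\<dots> = 1 / real (b0 L \<omega>) * (\<Sum>s\<in>?K. indicator (betti_ge k n) (htpy_type s))"
    using fin by (simp add: indicator_def sum.If_cases Int_def)
  also have "\<dots> = measure_pmf.prob (empirical_law \<nu> L \<omega>) (betti_ge k n)"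
    using b by (intro prob_empirical_law[symmetric]) simp
  finally show ?thesis .
qed

text \<open>For large \<open>L\<close> the event that the empirical law is far from the limit is less likely than the
  event that there are many good boxes, so some colouring has many good boxes and an empirical law
  close to the limit. The factor \<open>(1/2) ^ CARD('d)\<close> accounts for the boxes that do not fit into the
  window; \<open>L\<close> is taken larger than four times the radius so that the centres
  that remain fill at least half of each side.\<close>
lemma limit_law_ge:
  fixes \<mu> \<nu> :: "(real ^ 'd::finite) set set pmf"
  assumes lim: "is_limit_law p \<nu> \<mu>" and k: "0 < k" and \<sigma>: "inj_on \<sigma> {..k}" and n: "real n \<le> m"
    and q: "q > 0" "\<And>x :: int ^ 'd. measure (percolation p) {\<omega>. good \<sigma> k J m x \<omega>} \<ge> q"
  shows "measure_pmf.prob \<mu> (betti_ge k n) \<ge> q / 2 * (1 / 2) ^ CARD('d)"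
proof (rule ccontr)
  interpret prob_space "percolation p :: (int ^ 'd \<Rightarrow> bool) measure" by (rule prob_space_percolation)
  let ?T = "betti_ge k n" and ?R = "radius k J"
  let ?\<delta> = "q / 2 * (1 / 2) ^ CARD('d)"
  assume "\<not> ?thesis"
  then have less: "measure_pmf.prob \<mu> ?T < ?\<delta>" by simp
  define \<epsilon> where "\<epsilon> = (?\<delta> - measure_pmf.prob \<mu> ?T) / 2"
  have \<epsilon>: "\<epsilon> > 0" using less by (simp add: \<epsilon>_def)
  let ?V = "\<lambda>L. {\<omega>. tv_dist (empirical_law \<nu> L \<omega>) \<mu> > \<epsilon>}"
  have "(\<lambda>L. prob (?V L)) \<longlonglongrightarrow> 0" using lim \<epsilon> by (simp add: is_limit_law_def)
  then have "\<forall>\<^sub>F L in sequentially. prob (?V L) < q / 2" using q(1) by (intro order_tendstoD) auto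
  then obtain L0 where L0: "\<And>L. L \<ge> L0 \<Longrightarrow> prob (?V L) < q / 2" by (auto simp: eventually_sequentially)
  define L where "L = max L0 (nat (4 * ?R + 1))"
  have L: "prob (?V L) < q / 2" "4 * ?R < int L" using L0[of L] radius_pos[of k J] by (auto simp: L_def)
  have L_pos: "L > 0" using L(2) radius_pos[of k J] by linarith
  define I :: "(int ^ 'd) set" where
    "I = {x. \<forall>i. - (int L div 2) + ?R \<le> x $ i \<and> x $ i < int L - int L div 2 - ?R}"
  have I: "finite I" "card I = nat (int L - 2 * ?R) ^ CARD('d)"
    unfolding I_def using card_int_interval_vec[where 'd = 'd, of "- (int L div 2) + ?R" "int L - int L div 2 - ?R"]
    by (simp_all add: algebra_simps)
  have half: "real L / 2 \<le> real (nat (int L - 2 * ?R))" using L(2) radius_pos[of k J] by linarith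
  then have cardI: "(real L / 2) ^ CARD('d) \<le> real (card I)"
    unfolding I(2) of_nat_power by (intro power_mono) auto
  have cardI_pos: "0 < (real L / 2) ^ CARD('d)" using L_pos by simp
  then have I_ne: "I \<noteq> {}" using cardI by auto
  let ?N = "\<lambda>\<omega>. card {x \<in> I. good \<sigma> k J m x \<omega>}"
  let ?E = "{\<omega>. q / 2 * card I \<le> real (?N \<omega>)}"
  have E: "q / 2 \<le> prob ?E"
    using prob_many_events_ge[OF I(1) sets_good q(2) I_ne] q(1) by simp
  have "\<not> ?E \<subseteq> ?V L"
  proof
    assume "?E \<subseteq> ?V L"
    then have "prob ?E \<le> prob (?V L)" using sets_tv_event by (rule finite_measure_mono)
    then show False using E L(1) by simp
  qed
  then obtain \<omega> where "\<omega> \<in> ?E" "\<omega> \<notin> ?V L" by blast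
  then have \<omega>: "q / 2 * card I \<le> real (?N \<omega>)" "tv_dist (empirical_law \<nu> L \<omega>) \<mu> \<le> \<epsilon>"
    by (simp_all add: not_less)
  have "0 < q / 2 * card I" using q(1) cardI cardI_pos by simp
  then have N_pos: "?N \<omega> > 0" using \<omega>(1) by (auto intro!: Nat.gr0I)
  have "?\<delta> = q / 2 * ((real L / 2) ^ CARD('d)) / real L ^ CARD('d)"
    using L_pos by (simp add: power_divide)
  also have "\<dots> \<le> real (?N \<omega>) / real L ^ CARD('d)"
  proof (rule divide_right_mono)
    have "q / 2 * ((real L / 2) ^ CARD('d)) \<le> q / 2 * card I" using cardI q(1) by (intro mult_left_mono) auto
    then show "q / 2 * ((real L / 2) ^ CARD('d)) \<le> real (?N \<omega>)" using \<omega>(1) by linarith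
  qed simp
  also have "\<dots> \<le> measure_pmf.prob (empirical_law \<nu> L \<omega>) ?T"
    using k \<sigma> n I_def refl N_pos by (rule empirical_law_ge)
  also have "\<dots> \<le> measure_pmf.prob \<mu> ?T + \<epsilon>"
    using abs_diff_le_tv_dist[of "empirical_law \<nu> L \<omega>" ?T \<mu>] \<omega>(2) by linarith
  finally show False using \<epsilon> by (simp add: \<epsilon>_def field_simps)
qed

lemma power_diff_le:
  fixes a b :: real
  assumes "0 \<le> b" "b \<le> a"
  shows "a ^ Suc m - b ^ Suc m \<le> Suc m * (a - b) * a ^ m"
proof (induction m)
  case (Suc m)
  have "a ^ Suc (Suc m) - b ^ Suc (Suc m) = a * (a ^ Suc m - b ^ Suc m) + (a - b) * b ^ Suc m"
    by (simp add: algebra_simps)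
  also have "\<dots> \<le> a * (Suc m * (a - b) * a ^ m) + (a - b) * a ^ Suc m"
    using Suc.IH assms by (intro add_mono mult_left_mono power_mono) auto
  also have "\<dots> = Suc (Suc m) * (a - b) * a ^ Suc m" by (simp add: algebra_simps)
  finally show ?case .
qed simp

text \<open>The wall lies between two boxes whose side lengths differ by four.\<close>
lemma card_wall_le:
  fixes x :: "int ^ 'd::finite"
  assumes R: "1 \<le> R"
  shows "real (card (wall R x)) \<le> 4 * CARD('d) * real_of_int (2 * R + 3) ^ (CARD('d) - 1)"
proof -
  obtain m where m: "CARD('d) = Suc m" using gr0_conv_Suc zero_less_card_finite by blast
  have sub: "site_box (R - 1) x \<subseteq> site_box (R + 1) x" by (rule site_box_mono) simp
  have "wall R x \<subseteq> site_box (R + 1) x - site_box (R - 1) x"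
    using site_box_mono[of R "R + 1" x] site_box_mono[of "R - 1" R x] by (auto simp: wall_def mem_sphere_at)
  then have "card (wall R x) \<le> card (site_box (R + 1) x - site_box (R - 1) x)"
    using finite_site_box by (intro card_mono) auto
  also have "\<dots> = card (site_box (R + 1) x) - card (site_box (R - 1) x)"
    using finite_site_box sub by (rule card_Diff_subset)
  finally have "real (card (wall R x)) \<le> real (card (site_box (R + 1) x)) - real (card (site_box (R - 1) x))"
    using card_mono[OF finite_site_box sub] by linarith
  also have "\<dots> = real_of_int (2 * R + 3) ^ Suc m - real_of_int (2 * R - 1) ^ Suc m"
    using R by (simp add: card_site_box m algebra_simps)
  also have "\<dots> \<le> Suc m * (real_of_int (2 * R + 3) - real_of_int (2 * R - 1)) * real_of_int (2 * R + 3) ^ m"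
    using R by (intro power_diff_le) auto
  finally show ?thesis by (simp add: m mult.commute)
qed

text \<open>The number of gadgets in the grid is a power of the side of the box, so a side of order
  \<open>s = n powr (1/d)\<close> suffices for \<open>n\<close> attached gadgets. The wall then has at most a constant times
  \<open>s ^ (d-1)\<close> sites, which is the exponent sought; the constant factors are absorbed because
  \<open>s \<ge> 1\<close>.\<close>
theorem theorem1p3:
  fixes p :: real and k :: nat
  assumes "CARD('d::finite) \<ge> 2"
    and "0 < k" and "k < CARD('d)"
    and "critical_prob TYPE('d) < p" and "p < 1"
  shows "\<exists>\<eta>>0. \<forall>\<nu> \<mu> :: (real ^ 'd) set set pmf.
           set_pmf \<nu> \<subseteq> htpy_types \<longrightarrow> is_limit_law p \<nu> \<mu> \<longrightarrow>
           (\<forall>\<^sub>F n in sequentially. measure_pmf.prob \<mu> (betti_ge k n) \<ge>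
              exp (- \<eta> * real n powr ((real CARD('d) - 1) / real CARD('d))))"
proof -
  let ?d = "CARD('d)"
  let ?e = "(real ?d - 1) / real ?d"
  obtain \<theta> where \<theta>: "\<theta> > 0" "0 < p"
    "\<And>R (b :: int ^ 'd). 0 \<le> R \<Longrightarrow> measure (percolation p) {\<omega>. arm R b (blacks \<omega>)} \<ge> \<theta>"
    using arm_prob[OF assms(4)] assms(5) by (metis less_imp_le)
  obtain \<sigma> :: "nat \<Rightarrow> 'd" where \<sigma>: "inj_on \<sigma> {..k}"
    using card_le_inj[of "{..k}" "UNIV :: 'd set"] assms(3) by auto
  define \<kappa> where "\<kappa> = min p (1 - p)"
  have \<kappa>: "0 < \<kappa>" "\<kappa> < 1" using \<theta>(2) assms(5) by (auto simp: \<kappa>_def)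
  define q where "q = \<kappa> ^ ((2 * k + 9) ^ ?d) * \<theta>"
  have q: "q > 0" using \<kappa> \<theta> by (simp add: q_def)
  define a where "a = (4 * real k + 18) * ((2 / q) powr (1 / ?d) + 1) + 2 * real k + 13"
  \<comment> \<open>Here \<open>a * s\<close> bounds the side of the walled box, and \<open>c\<close> collects the factors in the final bound other
    than the probability of the wall.\<close>
  define c where "c = q / 4 * (1 / 2) ^ ?d"
  have c: "c > 0" using q by (simp add: c_def)
  have a: "a > 0" unfolding a_def by (intro add_nonneg_pos add_nonneg_nonneg mult_nonneg_nonneg) auto
  define \<eta> where "\<eta> = \<bar>ln c\<bar> + 4 * ?d * a ^ (?d - 1) * (- ln \<kappa>)"
  have "4 * ?d * a ^ (?d - 1) * (- ln \<kappa>) > 0" using a \<kappa> by (intro mult_pos_pos) auto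
  then have \<eta>: "\<eta> > 0" unfolding \<eta>_def by linarith
  have main: "measure_pmf.prob \<mu> (betti_ge k n) \<ge> exp (- \<eta> * real n powr ?e)"
    if lim: "is_limit_law p \<nu> \<mu>" and n: "n \<ge> 1" for \<nu> \<mu> :: "(real ^ 'd) set set pmf" and n
  proof -
    define s where "s = real n powr (1 / ?d)"
    have s1: "s \<ge> 1" using n by (simp add: s_def ge_one_powr_ge_zero)
    have s_d: "s ^ ?d = real n" using n by (simp add: s_def powr_realpow[symmetric] powr_powr)
    have s_e: "s ^ (?d - 1) = real n powr ?e"
      using n assms(1) by (simp add: s_def powr_realpow[symmetric] powr_powr of_nat_diff)
    \<comment> \<open>The least \<open>J\<close> with \<open>q / 2 * J ^ d \<ge> n\<close>.\<close>
    define J where "J = nat \<lceil>(2 / q) powr (1 / ?d) * s\<rceil>"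
    have J_ge: "(2 / q) powr (1 / ?d) * s \<le> real J" unfolding J_def by linarith
    have J_le: "real J \<le> ((2 / q) powr (1 / ?d) + 1) * s"
    proof -
      have "0 \<le> (2 / q) powr (1 / ?d) * s" using s1 by simp
      then have "real J \<le> (2 / q) powr (1 / ?d) * s + 1" unfolding J_def by linarith
      then show ?thesis using s1 by (simp add: algebra_simps)
    qed
    define m where "m = q / 2 * (2 * J + 1) ^ ?d"
    have "real n = q / 2 * ((2 / q) powr (1 / ?d) * s) ^ ?d"
      using q s_d by (simp add: power_mult_distrib powr_realpow[symmetric] powr_powr)
    also have "\<dots> \<le> m"
      unfolding m_def using q J_ge s1 by (auto intro!: mult_left_mono power_mono)
    finally have nm: "real n \<le> m" .
    define w where "w = 4 * ?d * a ^ (?d - 1) * s ^ (?d - 1)"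
    have R: "real_of_int (2 * radius k J + 3) \<le> a * s"
    proof -
      have "real_of_int (2 * radius k J + 3) = (4 * real k + 18) * real J + (2 * real k + 13)"
        by (simp add: radius_def algebra_simps)
      also have "\<dots> \<le> (4 * real k + 18) * (((2 / q) powr (1 / ?d) + 1) * s) + (2 * real k + 13) * s"
        using J_le s1 mult_left_mono[OF s1, of "2 * real k + 13"] by (intro add_mono mult_left_mono) auto
      also have "\<dots> = a * s" by (simp add: a_def algebra_simps)
      finally show ?thesis .
    qed
    have arm: "measure (percolation p) {\<omega>. arm (2 * radius k J) b (blacks \<omega>)} \<ge> \<theta>" for b :: "int ^ 'd"
      using \<theta>(3)[of "2 * radius k J" b] radius_pos[of k J] by simp
    have wall: "real (card (wall (radius k J) x)) \<le> w" for x :: "int ^ 'd"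
    proof -
      have "real (card (wall (radius k J) x)) \<le> 4 * ?d * real_of_int (2 * radius k J + 3) ^ (?d - 1)"
        by (rule card_wall_le) (simp add: radius_def)
      also have "\<dots> \<le> 4 * ?d * (a * s) ^ (?d - 1)"
        using R radius_pos[of k J] by (intro mult_left_mono power_mono) auto
      finally show ?thesis by (simp add: w_def power_mult_distrib mult.assoc)
    qed
    have "measure_pmf.prob \<mu> (betti_ge k n) \<ge> (\<kappa> powr w * (q / 2)) / 2 * (1 / 2) ^ ?d"
    proof (rule limit_law_ge[OF lim assms(2) \<sigma> nm])
      show "\<kappa> powr w * (q / 2) > 0" using \<kappa> q by simp
      fix x :: "int ^ 'd"
      have "\<kappa> powr w * (q / 2) \<le> \<kappa> ^ card (wall (radius k J) x) * (q / 2)"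
      proof (rule mult_right_mono)
        have "\<kappa> powr w \<le> \<kappa> powr real (card (wall (radius k J) x))"
          using \<kappa> wall[of x] by (intro powr_mono') auto
        then show "\<kappa> powr w \<le> \<kappa> ^ card (wall (radius k J) x)" using \<kappa> by (simp add: powr_realpow)
      qed (use q in simp)
      also have "\<dots> \<le> measure (percolation p) {\<omega>. good \<sigma> k J m x \<omega>}"
        unfolding m_def \<kappa>_def
        by (rule prob_good[OF assms(1) _ _ arm _ q_def[unfolded \<kappa>_def]])
          (use \<theta>(1,2) assms(5) in simp_all)
      finally show "\<kappa> powr w * (q / 2) \<le> measure (percolation p) {\<omega>. good \<sigma> k J m x \<omega>}" .
    qed
    moreover have "exp (- \<eta> * real n powr ?e) \<le> (\<kappa> powr w * (q / 2)) / 2 * (1 / 2) ^ ?d"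
    proof -
      have t1: "s ^ (?d - 1) \<ge> 1" using s1 by (rule one_le_power)
      have "- ln c \<le> \<bar>ln c\<bar> * s ^ (?d - 1)"
        using mult_left_mono[OF t1, of "\<bar>ln c\<bar>"] by linarith
      then have "- \<eta> * s ^ (?d - 1) \<le> ln c + w * ln \<kappa>"
        by (simp add: \<eta>_def w_def algebra_simps)
      then have "exp (- \<eta> * s ^ (?d - 1)) \<le> exp (ln c + w * ln \<kappa>)" by simp
      also have "\<dots> = c * \<kappa> powr w" using c \<kappa> by (simp add: exp_add powr_def)
      finally show ?thesis unfolding s_e by (simp add: c_def algebra_simps)
    qed
    ultimately show ?thesis by linarith
  qed
  show ?thesis
  proof (intro exI[of _ \<eta>] conjI allI impI)
    fix \<nu> \<mu> :: "(real ^ 'd) set set pmf"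
    assume "is_limit_law p \<nu> \<mu>"
    then show "\<forall>\<^sub>F n in sequentially. measure_pmf.prob \<mu> (betti_ge k n) \<ge> exp (- \<eta> * real n powr ?e)"
      using main by (intro eventually_sequentiallyI[of 1]) blast
  qed (rule \<eta>)
qed

end
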